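(* Consider the range space whose ground set is the set of hyperplanes in $\mathbb{R}^d$. Its ranges are indexed by the vertical prisms $\sigma\in\Sigma$, the range of $\sigma$ being the set of hyperplanes that intersect the interior of $\sigma$. The VC-dimension of this range space is at least $1+d(d+1)/2$ and at most $O(d^3)$.
   Context: $\Sigma$ is the family of all vertical prisms in $\mathbb{R}^d$ of the following form. Such a prism is the set of points $x=(x_1,\dots,x_d)$ satisfying, for $i=1,\dots,d$, $$a^-_{i,1}x_1+\dots+a^-_{i,i-1}x_{i-1}+b^-_i\ \le\ x_i\ \le\ a^+_{i,1}x_1+\dots+a^+_{i,i-1}x_{i-1}+b^+_i,$$ for arbitrary real parameters $a^\pm_{i,j}$ and $b^\pm_i$. For $i=1$ this reads $b_1^-\le x_1\le b_1^+$. Any of these $2d$ inequalities may be omitted. A set of hyperplanes is shattered if each of its subsets is the set of its hyperplanes meeting the interior of some prism in $\Sigma$. The VC-dimension is the largest size of a shattered set. *)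

theory Defs
  imports Complex_Main "HOL-Library.Extended_Nat"
begin

text \<open>Points of R^d are represented as functions nat => real vanishing at all
  indices >= d; coordinate i (0-based) corresponds to x_(i+1) of the paper.\<close>

definition Rd :: "nat \<Rightarrow> (nat \<Rightarrow> real) set" where
  "Rd d = {x. \<forall>i\<ge>d. x i = 0}"

text \<open>Interior relative to R^d (the box/sup-norm neighbourhoods give the
  standard Euclidean topology of R^d).\<close>
definition interior_d :: "nat \<Rightarrow> (nat \<Rightarrow> real) set \<Rightarrow> (nat \<Rightarrow> real) set" where
  "interior_d d S = {x \<in> Rd d. \<exists>e>0. \<forall>y\<in>Rd d. (\<forall>i<d. \<bar>y i - x i\<bar> < e) \<longrightarrow> y \<in> S}"

definition hyperplanes :: "nat \<Rightarrow> (nat \<Rightarrow> real) set set" where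
  "hyperplanes d = {H. \<exists>a b. (\<exists>i<d. a i \<noteq> 0) \<and>
      H = {x \<in> Rd d. (\<Sum>i<d. a i * x i) = b}}"

definition prism :: "nat \<Rightarrow> nat set \<Rightarrow> nat set \<Rightarrow> (nat \<Rightarrow> nat \<Rightarrow> real) \<Rightarrow> (nat \<Rightarrow> real)
    \<Rightarrow> (nat \<Rightarrow> nat \<Rightarrow> real) \<Rightarrow> (nat \<Rightarrow> real) \<Rightarrow> (nat \<Rightarrow> real) set" where
  "prism d L U am bm ap bp = {x \<in> Rd d. \<forall>i<d.
      (i \<in> L \<longrightarrow> (\<Sum>j<i. am i j * x j) + bm i \<le> x i) \<and>
      (i \<in> U \<longrightarrow> x i \<le> (\<Sum>j<i. ap i j * x j) + bp i)}"

definition Sigma_prisms :: "nat \<Rightarrow> (nat \<Rightarrow> real) set set" where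
  "Sigma_prisms d = {P. \<exists>L U am bm ap bp. P = prism d L U am bm ap bp}"

definition shattered :: "nat \<Rightarrow> (nat \<Rightarrow> real) set set \<Rightarrow> bool" where
  "shattered d S \<longleftrightarrow> S \<subseteq> hyperplanes d \<and>
     (\<forall>T\<subseteq>S. \<exists>\<sigma>\<in>Sigma_prisms d. {H\<in>S. H \<inter> interior_d d \<sigma> \<noteq> {}} = T)"

definition vc_dim :: "nat \<Rightarrow> enat" where
  "vc_dim d = Sup {enat (card S) | S. finite S \<and> shattered d S}"

end

theory Submission
  imports Defs "HOL-Analysis.Function_Topology" "Jordan_Normal_Form.Determinant"
begin

text \<open>
  Upper bound. An omitted inequality may be replaced by one too weak to affect the finitely many
  relevant points, so the ranges on a set of hyperplanes are determined by a vector of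
  \<open>2d(d+1)\<close> real parameters. A hyperplane meets an open prism iff two homogeneous strict systems in
  \<open>d + 1\<close> unknowns are feasible; a feasible system has a basic solution, so by Cramer's
  rule feasibility is a Boolean function of the signs of \<open>2\<^sup>O\<^sup>(\<^sup>d\<^sup>)\<close> polynomials of degree \<open>O(d)\<close> in the
  parameters. The number of sign patterns of \<open>M\<close> polynomials of degree \<open>D\<close> in \<open>K\<close> variables is at
  most \<open>(2MD + 1)\<^sup>K\<close>: let \<open>F\<close> be the product of their squares and \<open>E = 2MD\<close>. Every sign cell contains a
  critical point of \<open>F - \<epsilon> \<Sum> x\<^sub>i\<^sup>E\<^sup>+\<^sup>2\<close>, and the critical equations have the form
  \<open>x\<^sub>i\<^sup>E\<^sup>+\<^sup>1 = g\<^sub>i(x)\<close> with \<open>deg g\<^sub>i \<le> E\<close>, hence at most \<open>(E + 1)\<^sup>K\<close> common solutions. Comparing with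
  \<open>2\<^sup>m\<close> gives \<open>m = O(d\<^sup>3)\<close>.

  Lower bound. The upper bounds of a prism have \<open>d(d+1)/2\<close> coefficients in total, and for each of them
  there is a hyperplane that meets the prism or not according to its value; one more hyperplane is
  controlled by a lower bound.
\<close>

subsection \<open>Polynomial functions\<close>

text \<open>The polynomial functions in the first \<open>K\<close> coordinates, with
  \<open>t\<close> an upper bound for the total degree. Adding one variable at a time makes both the
  closure properties and the later reduction of monomials rule inductions.\<close>

inductive polyf :: "nat \<Rightarrow> nat \<Rightarrow> ((nat \<Rightarrow> real) \<Rightarrow> real) \<Rightarrow> bool" for K where
  const: "polyf K t (\<lambda>_. c)"
| var: "polyf K t f \<Longrightarrow> i < K \<Longrightarrow> polyf K (Suc t) (\<lambda>x. x i * f x)"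
| add: "polyf K t f \<Longrightarrow> polyf K t g \<Longrightarrow> polyf K t (\<lambda>x. f x + g x)"

lemma polyf_mono: "polyf K s f \<Longrightarrow> s \<le> t \<Longrightarrow> polyf K t f"
proof (induction arbitrary: t rule: polyf.induct)
  case (var s f i)
  then obtain u where "t = Suc u" "s \<le> u" by (metis Suc_le_D Suc_le_mono)
  with var show ?case by (simp add: polyf.var)
qed (auto intro: polyf.intros)

lemma polyf_coord: "i < K \<Longrightarrow> polyf K (Suc t) (\<lambda>x. x i)"
  using polyf.var[OF polyf.const[of K t 1], of i] by simp

lemma polyf_cmult: "polyf K t f \<Longrightarrow> polyf K t (\<lambda>x. c * f x)"
proof (induction rule: polyf.induct)
  case (var t f i)
  from polyf.var[OF var.IH var.hyps(2)] show ?case by (simp add: mult.left_commute)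
qed (auto intro: polyf.intros simp: distrib_left)

lemma polyf_mult: "polyf K s f \<Longrightarrow> polyf K t g \<Longrightarrow> polyf K (s + t) (\<lambda>x. f x * g x)"
proof (induction rule: polyf.induct)
  case (const s c)
  show ?case by (rule polyf_mono[OF polyf_cmult[OF const]]) simp
next
  case (var s f i)
  from polyf.var[OF var.IH[OF var.prems] var.hyps(2)] show ?case by (simp add: mult.assoc)
qed (auto intro: polyf.intros simp: distrib_right)

lemma polyf_diff: "polyf K t f \<Longrightarrow> polyf K t g \<Longrightarrow> polyf K t (\<lambda>x. f x - g x)"
  using polyf.add[of K t f "\<lambda>x. -1 * g x"] polyf_cmult[of K t g "-1"] by simp

lemma polyf_sum: "(\<And>a. a \<in> A \<Longrightarrow> polyf K t (f a)) \<Longrightarrow> polyf K t (\<lambda>x. \<Sum>a\<in>A. f a x)"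
  by (induction A rule: infinite_finite_induct) (auto intro: polyf.intros)

lemma polyf_prod:
  "(\<And>a. a \<in> A \<Longrightarrow> polyf K t (f a)) \<Longrightarrow> polyf K (card A * t) (\<lambda>x. \<Prod>a\<in>A. f a x)"
  by (induction A rule: infinite_finite_induct) (auto intro: polyf.intros polyf_mult)

lemma polyf_continuous: "polyf K t f \<Longrightarrow> continuous_on UNIV f"
  by (induction rule: polyf.induct)
    (auto intro!: continuous_intros continuous_on_product_coordinates)

text \<open>The degree bound is kept rather than lowered: the critical equations only require
  right-hand sides of degree at most \<open>E\<close>.\<close>

lemma polyf_derivative:
  assumes "polyf K t f"
  shows "\<exists>g. polyf K t g \<and> (\<forall>x. ((\<lambda>u. f (x(i := u))) has_real_derivative g x) (at (x i)))"
  using assms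
proof (induction rule: polyf.induct)
  case (const t c)
  show ?case by (rule exI[of _ "\<lambda>_. 0"]) (auto intro: polyf.intros)
next
  case (var t f j)
  then obtain g where g: "polyf K t g"
    "\<And>x. ((\<lambda>u. f (x(i := u))) has_real_derivative g x) (at (x i))" by blast
  show ?case
  proof (cases "j = i")
    case True
    have "polyf K (Suc t) (\<lambda>x. f x + x i * g x)"
      by (rule polyf.add[OF polyf_mono[OF var.hyps(1)] polyf.var[OF g(1)]])
        (use var True in auto)
    moreover have "((\<lambda>u. (x(i := u)) j * f (x(i := u))) has_real_derivative f x + x i * g x)
        (at (x i))" for x
      using DERIV_mult[OF DERIV_ident g(2)[of x]] True by (simp add: mult.commute add.commute)
    ultimately show ?thesis by blast
  next
    case False
    have "polyf K (Suc t) (\<lambda>x. x j * g x)"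
      using var g(1) by (auto intro: polyf.intros)
    moreover have "((\<lambda>u. (x(i := u)) j * f (x(i := u))) has_real_derivative x j * g x)
        (at (x i))" for x
      using DERIV_cmult[OF g(2)[of x], of "x j"] False by simp
    ultimately show ?thesis by blast
  qed
next
  case (add t f g)
  then obtain f' g' where
    f': "polyf K t f'" "\<And>x. ((\<lambda>u. f (x(i := u))) has_real_derivative f' x) (at (x i))" and
    g': "polyf K t g'" "\<And>x. ((\<lambda>u. g (x(i := u))) has_real_derivative g' x) (at (x i))" by blast
  show ?case
  proof (intro exI conjI allI)
    show "polyf K t (\<lambda>x. f' x + g' x)" by (rule polyf.add[OF f'(1) g'(1)])
    show "((\<lambda>u. f (x(i := u)) + g (x(i := u))) has_real_derivative f' x + g' x) (at (x i))" for x
      by (rule DERIV_add[OF f'(2) g'(2)])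
  qed
qed

text \<open>For \<open>R \<ge> 1\<close> the lower powers of \<open>R\<close> are dominated by
  \<open>R ^ t\<close>. The estimate later lets a penalty of degree \<open>E + 2\<close> win on the
  boundary of a large box.\<close>

lemma polyf_growth:
  assumes "polyf K t f"
  shows "\<exists>C\<ge>0. \<forall>R\<ge>1. \<forall>x. (\<forall>i<K. \<bar>x i\<bar> \<le> R) \<longrightarrow> \<bar>f x\<bar> \<le> C * R ^ t"
  using assms
proof (induction rule: polyf.induct)
  case (const t c)
  have "\<bar>c\<bar> \<le> \<bar>c\<bar> * R ^ t" if "R \<ge> 1" for R :: real
    using that by (simp add: mult_left_mono[of 1 "R ^ t" "\<bar>c\<bar>", simplified])
  then show ?case by (intro exI[of _ "\<bar>c\<bar>"]) auto
next
  case (var t f i)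
  then obtain C where C: "C \<ge> 0"
    "\<And>R x. R \<ge> 1 \<Longrightarrow> (\<forall>i<K. \<bar>x i\<bar> \<le> R) \<Longrightarrow> \<bar>f x\<bar> \<le> C * R ^ t" by blast
  have "\<bar>x i * f x\<bar> \<le> C * R ^ Suc t" if "R \<ge> 1" "\<forall>i<K. \<bar>x i\<bar> \<le> R" for R x
  proof -
    have "\<bar>x i * f x\<bar> \<le> R * (C * R ^ t)"
      unfolding abs_mult using C that var.hyps(2) by (intro mult_mono) auto
    then show ?thesis by (simp add: ac_simps)
  qed
  with C(1) show ?case by blast
next
  case (add t f g)
  then obtain C D where C: "C \<ge> 0"
    "\<And>R x. R \<ge> 1 \<Longrightarrow> (\<forall>i<K. \<bar>x i\<bar> \<le> R) \<Longrightarrow> \<bar>f x\<bar> \<le> C * R ^ t" and D: "D \<ge> 0"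
    "\<And>R x. R \<ge> 1 \<Longrightarrow> (\<forall>i<K. \<bar>x i\<bar> \<le> R) \<Longrightarrow> \<bar>g x\<bar> \<le> D * R ^ t" by metis
  have "\<bar>f x + g x\<bar> \<le> (C + D) * R ^ t" if "R \<ge> 1" "\<forall>i<K. \<bar>x i\<bar> \<le> R" for R x
    using C(2)[OF that] D(2)[OF that] by (simp add: distrib_right)
  with C(1) D(1) show ?case by (intro exI[of _ "C + D"]) auto
qed

text \<open>For each other point \<open>x\<close> take the factor \<open>y (i x) - x (i x)\<close>,
  where \<open>i x\<close> is a coordinate in which \<open>x\<close> differs from
  \<open>x0\<close>.\<close>

lemma polyf_interpolation:
  assumes "finite X" "\<And>x. x \<in> X \<Longrightarrow> \<forall>i\<ge>K. x i = 0" "x0 \<in> X"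
  shows "\<exists>t f. polyf K t f \<and> f x0 \<noteq> 0 \<and> (\<forall>x\<in>X - {x0}. f x = 0)"
proof -
  have "\<exists>i<K. x i \<noteq> x0 i" if "x \<in> X - {x0}" for x
  proof (rule ccontr)
    assume "\<not> ?thesis"
    then have "x i = x0 i" for i using assms(2)[of x] assms(2)[of x0] assms(3) that
      by (cases "i < K") auto
    then show False using that by auto
  qed
  then obtain i where i: "\<And>x. x \<in> X - {x0} \<Longrightarrow> i x < K \<and> x (i x) \<noteq> x0 (i x)" by metis
  let ?f = "\<lambda>y. \<Prod>x\<in>X - {x0}. (y (i x) - x (i x))"
  have "polyf K (card (X - {x0}) * 1) ?f"
    using i by (intro polyf_prod) (auto intro!: polyf_diff polyf.const polyf_coord[of _ _ 0, simplified])
  moreover have "?f x0 \<noteq> 0" using i assms(1) by (simp add: prod_zero_iff) fastforce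
  moreover have "\<forall>x\<in>X - {x0}. ?f x = 0" using assms(1) by (auto intro!: prod_zero)
  ultimately show ?thesis by blast
qed

section \<open>Counting the solutions of \<open>x i ^ Suc E = g i x\<close>\<close>

lemma underdetermined_homogeneous:
  fixes a :: "'b \<Rightarrow> 'a \<Rightarrow> real"
  assumes "finite B" "finite X" "card B < card X"
  shows "\<exists>c. (\<exists>x\<in>X. c x \<noteq> 0) \<and> (\<forall>b\<in>B. (\<Sum>x\<in>X. c x * a b x) = 0)"
  using assms
proof (induction B arbitrary: X a rule: finite_induct)
  case empty
  then obtain x where "x \<in> X" by (metis card.empty card_gt_0_iff ex_in_conv)
  then show ?case by (intro exI[of _ "\<lambda>_. 1"]) auto
next
  case (insert b B)
  show ?case
  proof (cases "\<exists>p\<in>X. a b p \<noteq> 0")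
    case False
    from insert obtain c where c: "\<exists>x\<in>X. c x \<noteq> 0" "\<forall>b\<in>B. (\<Sum>x\<in>X. c x * a b x) = 0"
      by (metis Suc_lessD card_insert_disjoint)
    have "(\<Sum>x\<in>X. c x * a b x) = 0" using False by (auto intro!: sum.neutral)
    with c show ?thesis by blast
  next
    case True
    then obtain p where p: "p \<in> X" "a b p \<noteq> 0" by blast
    let ?a = "\<lambda>e x. a e x - a e p * a b x / a b p"
    have "card B < card (X - {p})" using insert p by (simp add: card_Diff_singleton)
    with insert.IH[of "X - {p}" ?a] insert.prems obtain c
      where c: "\<exists>x\<in>X - {p}. c x \<noteq> 0"
        "\<forall>e\<in>B. (\<Sum>x\<in>X - {p}. c x * ?a e x) = 0" by auto
    let ?s = "\<Sum>x\<in>X - {p}. c x * a b x"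
    \<comment> \<open>The value at the pivot is the one forced by equation \<open>b\<close>.\<close>
    define c' where "c' = c(p := - ?s / a b p)"
    have *: "(\<Sum>x\<in>X. c' x * a e x) = (\<Sum>x\<in>X - {p}. c x * a e x) - ?s / a b p * a e p" for e
      using p insert.prems(1) by (subst sum.remove[of X p]) (auto simp: c'_def intro!: sum.cong)
    have "(\<Sum>x\<in>X. c' x * a e x) = 0" if "e \<in> insert b B" for e
    proof (cases "e = b")
      case True
      then show ?thesis using p * by simp
    next
      case False
      then have "(\<Sum>x\<in>X - {p}. c x * ?a e x) = 0" using c that by auto
      then have "(\<Sum>x\<in>X - {p}. c x * a e x) - (\<Sum>x\<in>X - {p}. c x * (a e p * a b x / a b p)) = 0"
        by (simp add: right_diff_distrib sum_subtractf)
      also have "(\<Sum>x\<in>X - {p}. c x * (a e p * a b x / a b p)) = ?s / a b p * a e p"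
        by (simp add: sum_divide_distrib sum_distrib_right sum_distrib_left mult_ac)
      finally show ?thesis using * by simp
    qed
    moreover have "\<exists>x\<in>X. c' x \<noteq> 0" using c(1) by (auto simp: c'_def)
    ultimately show ?thesis by blast
  qed
qed

definition monom_fun :: "nat \<Rightarrow> (nat \<Rightarrow> nat) \<Rightarrow> (nat \<Rightarrow> real) \<Rightarrow> real" where
  "monom_fun K e x = (\<Prod>i<K. x i ^ e i)"

lemma monom_fun_add: "monom_fun K (\<lambda>i. e i + e' i) x = monom_fun K e x * monom_fun K e' x"
  by (simp add: monom_fun_def power_add prod.distrib)

lemma monom_fun_single:
  assumes "i < K" shows "monom_fun K (\<lambda>j. if j = i then n else 0) x = x i ^ n"
proof -
  have "(\<Prod>j<K. x j ^ (if j = i then n else 0)) = (\<Prod>j<K. if j = i then x j ^ n else 1)"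
    by (rule prod.cong) auto
  then show ?thesis using assms by (simp add: monom_fun_def)
qed

text \<open>Here \<open>c\<close> acts as a linear functional on functions on \<open>X\<close>. The
  factor \<open>monom_fun K e\<close> is carried along so that the \<open>var\<close> case can
  absorb its variable into \<open>e\<close>.\<close>

lemma functional_vanishes_on_polyf:
  fixes c :: "(nat \<Rightarrow> real) \<Rightarrow> real"
  assumes "polyf K t f"
    and "\<And>e'. (\<Sum>i<K. e' i) \<le> (\<Sum>i<K. e i) + t \<Longrightarrow> (\<Sum>x\<in>X. c x * monom_fun K e' x) = 0"
  shows "(\<Sum>x\<in>X. c x * (monom_fun K e x * f x)) = 0"
  using assms
proof (induction arbitrary: e rule: polyf.induct)
  case (const t k)
  have "(\<Sum>x\<in>X. c x * (monom_fun K e x * k)) = (\<Sum>x\<in>X. c x * monom_fun K e x) * k"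
    by (simp add: sum_distrib_right mult.assoc)
  then show ?case using const[of e] by simp
next
  case (var t f i)
  let ?d = "\<lambda>j. if j = i then 1 else 0 :: nat"
  let ?e = "\<lambda>j. e j + ?d j"
  have "(\<Sum>j<K. ?e j) = Suc (\<Sum>j<K. e j)"
    using var.hyps(2) by (simp add: sum.distrib)
  then have "(\<Sum>x\<in>X. c x * (monom_fun K ?e x * f x)) = 0"
    using var.prems by (intro var.IH) auto
  then show ?case
    using monom_fun_single[OF var.hyps(2), of 1] by (simp add: monom_fun_add mult_ac)
next
  case (add t f g)
  then show ?case by (simp add: distrib_left sum.distrib)
qed

text \<open>The equations rewrite every monomial, as a function on \<open>X\<close>, to a combination of those
  with all exponents at most \<open>E\<close>, and these must separate the points of \<open>X\<close>.\<close>

lemma card_solutions_le: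
  assumes X: "finite X" "\<And>x. x \<in> X \<Longrightarrow> \<forall>i\<ge>K. x i = 0"
    and g: "\<And>i. i < K \<Longrightarrow> polyf K E (g i)"
    and eq: "\<And>x i. x \<in> X \<Longrightarrow> i < K \<Longrightarrow> x i ^ Suc E = g i x"
  shows "card X \<le> Suc E ^ K"
proof (rule ccontr)
  assume "\<not> ?thesis"
  \<comment> \<open>With more points than the \<open>Suc E ^ K\<close> reduced exponents, a nonzero
    functional \<open>c\<close> kills all reduced monomials.\<close>
  define B where "B = {..<K} \<rightarrow>\<^sub>E {..E}"
  have B: "finite B" "card B = Suc E ^ K"
    unfolding B_def by (auto simp: card_PiE intro!: finite_PiE)
  then obtain c where c: "\<exists>x\<in>X. c x \<noteq> 0"
    "\<forall>e\<in>B. (\<Sum>x\<in>X. c x * monom_fun K e x) = 0"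
    using underdetermined_homogeneous[of B X "monom_fun K"] X(1) \<open>\<not> _\<close> by auto
  have mono: "(\<Sum>x\<in>X. c x * monom_fun K e x) = 0" for e
  proof (induction "\<Sum>i<K. e i" arbitrary: e rule: less_induct)
    case less
    show ?case
    proof (cases "\<forall>i<K. e i \<le> E")
      case True
      then have "restrict e {..<K} \<in> B" by (auto simp: B_def)
      moreover have "monom_fun K (restrict e {..<K}) = monom_fun K e"
        by (auto simp: monom_fun_def)
      ultimately show ?thesis using c(2) by metis
    next
      case False
      then obtain i where i: "i < K" "Suc E \<le> e i" by (auto simp: not_le)
      \<comment> \<open>Splitting off \<open>x i ^ Suc E\<close> and replacing it by
        \<open>g i\<close>, of degree at most \<open>E\<close>, strictly lowers the total
        degree.\<close>
      define e1 where "e1 = (\<lambda>j. if j = i then Suc E else 0)"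
      define e2 where "e2 = e(i := e i - Suc E)"
      have e: "e = (\<lambda>j. e1 j + e2 j)" using i by (auto simp: e1_def e2_def)
      have "(\<Sum>j<K. e1 j) = Suc E" using i by (simp add: e1_def)
      then have deg: "(\<Sum>j<K. e j) = Suc E + (\<Sum>j<K. e2 j)"
        by (subst e) (simp only: sum.distrib)
      have "(\<Sum>x\<in>X. c x * monom_fun K e x) = (\<Sum>x\<in>X. c x * (monom_fun K e2 x * g i x))"
      proof (rule sum.cong[OF refl])
        fix x assume "x \<in> X"
        have "monom_fun K e x = monom_fun K e1 x * monom_fun K e2 x"
          by (subst e) (rule monom_fun_add)
        also have "monom_fun K e1 x = g i x"
          using eq[OF \<open>x \<in> X\<close> i(1)] monom_fun_single[OF i(1)] by (simp add: e1_def)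
        finally show "c x * monom_fun K e x = c x * (monom_fun K e2 x * g i x)"
          by simp
      qed
      also have "\<dots> = 0"
        by (rule functional_vanishes_on_polyf[OF g[OF i(1)]]) (use less deg in auto)
      finally show ?thesis .
    qed
  qed
  \<comment> \<open>So \<open>c\<close> kills every polynomial function. One that vanishes on
    \<open>X\<close> except at \<open>x0\<close> isolates the nonzero coefficient
    \<open>c x0\<close>.\<close>
  from c(1) obtain x0 where x0: "x0 \<in> X" "c x0 \<noteq> 0" by blast
  obtain t f where f: "polyf K t f" "f x0 \<noteq> 0" "\<forall>x\<in>X - {x0}. f x = 0"
    using polyf_interpolation[OF X x0(1)] by blast
  have "(\<Sum>x\<in>X. c x * (monom_fun K (\<lambda>_. 0) x * f x)) = 0"
    by (rule functional_vanishes_on_polyf[OF f(1) mono])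
  then have "(\<Sum>x\<in>X. c x * f x) = 0" by (simp add: monom_fun_def)
  also have "(\<Sum>x\<in>X. c x * f x) = c x0 * f x0"
    using X(1) x0(1) f(3) by (subst sum.remove[of X x0]) (auto intro!: sum.neutral)
  finally show False using x0 f by simp
qed

subsection \<open>Counting sign patterns of polynomials\<close>

lemma DERIV_zero_at_local_max:
  fixes f :: "real \<Rightarrow> real"
  assumes "(f has_real_derivative l) (at x)" "eventually (\<lambda>u. f u \<le> f x) (at x)"
  shows "l = 0"
proof -
  from assms(2) obtain d where "d > 0" "\<And>u. u \<noteq> x \<Longrightarrow> dist u x < d \<Longrightarrow> f u \<le> f x"
    by (auto simp: eventually_at)
  then have "\<forall>u. \<bar>x - u\<bar> < d \<longrightarrow> f u \<le> f x"
    by (metis abs_minus_commute dist_real_def order_refl)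
  with assms(1) \<open>d > 0\<close> show ?thesis using DERIV_local_max by blast
qed

text \<open>Tychonoff: a product of closed intervals and, from index \<open>K\<close> on,
  singletons.\<close>

lemma compact_box:
  "compact {x :: nat \<Rightarrow> real. (\<forall>i<K. \<bar>x i\<bar> \<le> R) \<and> (\<forall>i\<ge>K. x i = 0)}"
proof -
  have "compactin (product_topology (\<lambda>_. euclidean) UNIV)
      (PiE UNIV (\<lambda>i::nat. if i < K then {-R..R} else {0::real}))"
    by (subst compactin_PiE) auto
  also have "PiE UNIV (\<lambda>i::nat. if i < K then {-R..R} else {0::real}) =
      {x. (\<forall>i<K. \<bar>x i\<bar> \<le> R) \<and> (\<forall>i\<ge>K. x i = 0)}"
    by (force simp: PiE_def Pi_def abs_le_iff split: if_splits)
  finally show ?thesis by (simp add: euclidean_product_topology)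
qed

text \<open>A maximum point of \<open>F - \<epsilon> \<Sum> x\<^sub>i\<^sup>E\<^sup>+\<^sup>2\<close> over the closed sign cell of \<open>y\<close>.\<close>

lemma critical_point_in_cell:
  assumes A: "finite A" "\<And>a. a \<in> A \<Longrightarrow> polyf K D (f a)"
    and F_def: "F = (\<lambda>x. \<Prod>a\<in>A. f a x * f a x)"
    and E: "even E" "polyf K E F"
    and G: "\<And>i x. i < K \<Longrightarrow> ((\<lambda>u. F (x(i := u))) has_real_derivative G i x) (at (x i))"
    and \<epsilon>: "\<epsilon> > 0"
    and y: "\<forall>i\<ge>K. y i = 0" "\<And>a. a \<in> A \<Longrightarrow> f a y \<noteq> 0"
      "F y > \<epsilon> * (\<Sum>i<K. y i ^ (E + 2))"
  shows "\<exists>x. (\<forall>i\<ge>K. x i = 0) \<and> (\<forall>a\<in>A. f a x * f a y > 0) \<and>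
    (\<forall>i<K. G i x = \<epsilon> * ((real E + 2) * x i ^ Suc E))"
proof -
  define \<Phi> where "\<Phi> = (\<lambda>x. F x - \<epsilon> * (\<Sum>i<K. x i ^ (E + 2)))"
  have pos: "x i ^ (E + 2) \<ge> 0" for x :: "nat \<Rightarrow> real" and i
    by (rule zero_le_even_power) (use E(1) in simp)
  obtain C where C: "C \<ge> 0"
    "\<And>R x. R \<ge> 1 \<Longrightarrow> (\<forall>i<K. \<bar>x i\<bar> \<le> R) \<Longrightarrow> \<bar>F x\<bar> \<le> C * R ^ E"
    using polyf_growth[OF E(2)] by blast
  \<comment> \<open>Large enough that \<open>C \<le> \<epsilon> * R\<^sup>2\<close> and that the box
    contains \<open>y\<close>.\<close>
  define R where "R = Max (insert (1 + C / \<epsilon>) ((\<lambda>i. \<bar>y i\<bar>) ` {..<K}))"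
  have R: "1 + C / \<epsilon> \<le> R" "\<And>i. i < K \<Longrightarrow> \<bar>y i\<bar> \<le> R" by (auto simp: R_def)
  with C(1) \<epsilon> have R1: "R \<ge> 1" by (smt (verit) divide_nonneg_pos)
  define box where "box = {x :: nat \<Rightarrow> real. (\<forall>i<K. \<bar>x i\<bar> \<le> R) \<and> (\<forall>i\<ge>K. x i = 0)}"
  \<comment> \<open>On the faces of the box the penalty outweighs the growth of \<open>F\<close>.
    Since \<open>\<Phi> y > 0\<close>, the maximum point found below lies off the faces.\<close>
  have boundary: "\<Phi> x \<le> 0" if x: "x \<in> box" "i < K" "\<bar>x i\<bar> = R" for x i
  proof -
    have "F x \<le> C * R ^ E" using C(2)[OF R1, of x] x(1) by (auto simp: box_def)
    also have "C \<le> \<epsilon> * R\<^sup>2"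
    proof -
      have "C \<le> \<epsilon> * R" using R(1) \<epsilon> by (simp add: field_simps)
      also have "\<dots> \<le> \<epsilon> * R\<^sup>2" using R1 \<epsilon> self_le_power[OF R1, of 2] by simp
      finally show ?thesis .
    qed
    then have "C * R ^ E \<le> \<epsilon> * R\<^sup>2 * R ^ E" using R1 by (intro mult_right_mono) auto
    also have "\<dots> = \<epsilon> * R ^ (E + 2)" by (simp add: power_add power2_eq_square mult_ac)
    also have "R ^ (E + 2) = x i ^ (E + 2)" using x(3) E(1) by (metis power_even_abs even_add even_numeral)
    also have "\<dots> \<le> (\<Sum>i<K. x i ^ (E + 2))" using x(2) pos by (intro member_le_sum) auto
    finally show ?thesis using \<epsilon> by (simp add: \<Phi>_def)
  qed
  define S where "S = box \<inter> (\<Inter>a\<in>A. {x. f a x * f a y \<ge> 0})"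
  have cont: "continuous_on UNIV \<Phi>"
    unfolding \<Phi>_def by (intro continuous_intros polyf_continuous[OF E(2)] continuous_on_product_coordinates)
  have "compact S" unfolding S_def
  proof (intro compact_Int_closed closed_INT ballI)
    show "compact box" unfolding box_def by (rule compact_box)
    fix a assume "a \<in> A"
    then have "continuous_on UNIV (f a)" using A polyf_continuous by blast
    then show "closed {x. 0 \<le> f a x * f a y}" by (intro closed_Collect_le continuous_intros)
  qed
  moreover have "y \<in> S" using R(2) y(1) by (auto simp: S_def box_def)
  ultimately obtain x where x: "x \<in> S" "\<And>z. z \<in> S \<Longrightarrow> \<Phi> z \<le> \<Phi> x"
    using continuous_attains_sup[of S \<Phi>] cont continuous_on_subset by blast
  have "\<Phi> x > 0" using x(2)[OF \<open>y \<in> S\<close>] y(3) by (simp add: \<Phi>_def)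
  \<comment> \<open>A positive product keeps every factor away from 0, which moves the maximum point
    from the closed sign cell into the open one.\<close>
  then have "F x > 0" using \<epsilon> sum_nonneg[of "{..<K}" "\<lambda>i. x i ^ (E + 2)"] pos
    unfolding \<Phi>_def by (smt (verit) mult_nonneg_nonneg)
  then have cell: "f a x * f a y > 0" if "a \<in> A" for a
  proof -
    have "f a x \<noteq> 0"
    proof
      assume "f a x = 0"
      then have "F x = 0" unfolding F_def using A(1) that by (intro prod_zero) auto
      with \<open>F x > 0\<close> show False by simp
    qed
    then show ?thesis using x(1) y(2)[OF that] that by (auto simp: S_def order_less_le)
  qed
  have "G i x = \<epsilon> * ((real E + 2) * x i ^ Suc E)" if i: "i < K" for i
  proof -
    let ?x = "\<lambda>u. x(i := u)"
    have sum: "(\<Sum>j<K. ?x u j ^ (E + 2)) = u ^ (E + 2) + (\<Sum>j\<in>{..<K} - {i}. x j ^ (E + 2))" for u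
      using i by (subst sum.remove[of _ i]) auto
    have "((\<lambda>u. \<Phi> (?x u)) has_real_derivative
        G i x - \<epsilon> * (real (E + 2) * x i ^ (E + 2 - Suc 0) + 0)) (at (x i))"
      unfolding \<Phi>_def sum
      by (intro DERIV_diff DERIV_cmult DERIV_add DERIV_const DERIV_pow G i)
    \<comment> \<open>Small moves of coordinate \<open>i\<close> stay in \<open>S\<close>: the signs
      of the \<open>f a\<close> persist by continuity, and \<open>x i\<close> is strictly inside its
      interval.\<close>
    moreover have "eventually (\<lambda>u. \<Phi> (?x u) \<le> \<Phi> (?x (x i))) (at (x i))"
    proof -
      have lim: "(f a \<circ> ?x) \<midarrow>x i\<rightarrow> f a x" if "a \<in> A" for a
      proof -
        have "polyf K D (f a)" using A(2) that .
        then obtain g where "((\<lambda>u. f a (?x u)) has_real_derivative g) (at (x i))"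
          using polyf_derivative by blast
        then have "isCont (\<lambda>u. f a (?x u)) (x i)" by (rule DERIV_isCont)
        then show ?thesis by (simp add: isCont_def o_def)
      qed
      have "eventually (\<lambda>u. f a (?x u) * f a y > 0) (at (x i))" if "a \<in> A" for a
        using order_tendstoD(1)[OF tendsto_mult_right[OF lim[OF that]], of 0 "f a y"] cell[OF that]
        by simp
      then have "eventually (\<lambda>u. \<forall>a\<in>A. f a (?x u) * f a y > 0) (at (x i))"
        using A(1) by (simp add: eventually_ball_finite)
      moreover have "\<bar>x i\<bar> < R"
        using boundary[of x i] x(1) i \<open>\<Phi> x > 0\<close> by (auto simp: S_def box_def order_less_le)
      then have "eventually (\<lambda>u. \<bar>u\<bar> < R) (at (x i))"
        by (intro order_tendstoD(2)[of abs "\<bar>x i\<bar>"] tendsto_intros) auto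
      ultimately show ?thesis
      proof eventually_elim
        case (elim u)
        then have "?x u \<in> S" using x(1) i by (auto simp: S_def box_def)
        then show ?case using x(2) by simp
      qed
    qed
    ultimately have "G i x - \<epsilon> * (real (E + 2) * x i ^ (E + 2 - Suc 0) + 0) = 0"
      by (rule DERIV_zero_at_local_max)
    then show ?thesis by (simp add: add.commute)
  qed
  with cell x(1) show ?thesis by (intro exI[of _ x]) (auto simp: S_def box_def)
qed

text \<open>Distinct elements of \<open>Y\<close> lie in distinct sign cells, hence have distinct
  critical points; these solve a system to which \<open>card_solutions_le\<close> applies.\<close>

lemma card_sign_patterns_le:
  assumes A: "finite A" "\<And>a. a \<in> A \<Longrightarrow> polyf K D (f a)"
    and Y: "finite Y" "\<And>y. y \<in> Y \<Longrightarrow> \<forall>i\<ge>K. y i = 0" "\<And>y a. y \<in> Y \<Longrightarrow> a \<in> A \<Longrightarrow> f a y \<noteq> 0"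
    and inj: "inj_on (\<lambda>y. {a\<in>A. f a y > 0}) Y"
  shows "card Y \<le> (2 * card A * D + 1) ^ K"
proof -
  define F where "F = (\<lambda>x. \<Prod>a\<in>A. f a x * f a x)"
  define E where "E = 2 * card A * D"
  have E: "even E" by (simp add: E_def)
  have "polyf K (card A * (D + D)) F"
    unfolding F_def using A by (intro polyf_prod polyf_mult) auto
  then have F: "polyf K E F" by (rule polyf_mono) (simp add: E_def)
  obtain G where G: "\<And>i. polyf K E (G i)"
    "\<And>i x. ((\<lambda>u. F (x(i := u))) has_real_derivative G i x) (at (x i))"
    using polyf_derivative[OF F] by metis
  have Fpos: "F y > 0" if "y \<in> Y" for y
    unfolding F_def by (intro prod_pos ballI)
      (use Y(3)[OF that] in \<open>simp add: zero_less_mult_iff linorder_neq_iff[symmetric]\<close>)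
  define N where "N = (\<lambda>y :: nat \<Rightarrow> real. 1 + (\<Sum>i<K. y i ^ (E + 2)))"
  have N: "N y > 0" for y :: "nat \<Rightarrow> real"
    unfolding N_def using E by (intro add_pos_nonneg sum_nonneg zero_le_even_power) auto
  \<comment> \<open>One \<epsilon> must serve all of \<open>Y\<close>. The summand 1 in
    \<open>N\<close> makes the denominators positive and the inequality below strict; the 1 under
    \<open>Min\<close> covers empty \<open>Y\<close>.\<close>
  define \<epsilon> where "\<epsilon> = Min (insert 1 ((\<lambda>y. F y / N y) ` Y))"
  have \<epsilon>: "\<epsilon> > 0" unfolding \<epsilon>_def using Y(1) Fpos N by (subst Min_gr_iff) auto
  have small: "F y > \<epsilon> * (\<Sum>i<K. y i ^ (E + 2))" if "y \<in> Y" for y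
  proof -
    have "\<epsilon> \<le> F y / N y" unfolding \<epsilon>_def using Y(1) that by (intro Min_le) auto
    then have "\<epsilon> * N y \<le> F y" using N[of y] by (simp add: field_simps)
    then show ?thesis using \<epsilon> by (simp add: N_def distrib_left)
  qed
  have "\<exists>x. (\<forall>i\<ge>K. x i = 0) \<and> (\<forall>a\<in>A. f a x * f a y > 0) \<and>
    (\<forall>i<K. G i x = \<epsilon> * ((real E + 2) * x i ^ Suc E))" if "y \<in> Y" for y
    by (rule critical_point_in_cell[OF A F_def E F G(2) \<epsilon>]) (use Y that small in auto)
  then obtain p where p: "\<And>y. y \<in> Y \<Longrightarrow> \<forall>i\<ge>K. p y i = 0"
    "\<And>y a. y \<in> Y \<Longrightarrow> a \<in> A \<Longrightarrow> f a (p y) * f a y > 0"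
    "\<And>y i. y \<in> Y \<Longrightarrow> i < K \<Longrightarrow> G i (p y) = \<epsilon> * ((real E + 2) * p y i ^ Suc E)"
    by metis
  have "inj_on p Y"
  proof (rule inj_onI)
    fix y z assume yz: "y \<in> Y" "z \<in> Y" "p y = p z"
    have "f a y > 0 \<longleftrightarrow> f a z > 0" if "a \<in> A" for a
      using p(2)[OF yz(1) that] p(2)[OF yz(2) that] yz(3) by (auto simp: zero_less_mult_iff)
    then have "{a \<in> A. 0 < f a y} = {a \<in> A. 0 < f a z}" by blast
    with inj yz(1,2) show "y = z" by (simp add: inj_on_def)
  qed
  then have "card Y = card (p ` Y)" by (simp add: card_image)
  also have "\<dots> \<le> Suc E ^ K"
  proof (rule card_solutions_le)
    show "polyf K E (\<lambda>x. 1 / (\<epsilon> * (real E + 2)) * G i x)" for i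
      by (rule polyf_cmult[OF G(1)])
    show "x i ^ Suc E = 1 / (\<epsilon> * (real E + 2)) * G i x" if x: "x \<in> p ` Y" and i: "i < K" for x i
    proof -
      from x obtain y where y: "y \<in> Y" "x = p y" by blast
      have "\<epsilon> * (real E + 2) \<noteq> 0" using \<epsilon> by simp
      then show ?thesis using p(3)[OF y(1) i] y(2) by (simp add: field_simps)
    qed
  qed (use Y p in auto)
  finally show ?thesis by (simp add: E_def)
qed

text \<open>Values 0 are now allowed. Subtracting a \<delta> below all positive values that occur
  makes every value nonzero and changes no positivity.\<close>

lemma card_positivity_patterns_le:
  assumes A: "finite A" "\<And>a. a \<in> A \<Longrightarrow> polyf K D (f a)"
    and Y: "finite Y" "\<And>y. y \<in> Y \<Longrightarrow> \<forall>i\<ge>K. y i = 0"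
    and inj: "inj_on (\<lambda>y. {a\<in>A. f a y > 0}) Y"
  shows "card Y \<le> (2 * card A * D + 1) ^ K"
proof -
  define V where "V = {v. v > 0 \<and> (\<exists>a\<in>A. \<exists>y\<in>Y. v = f a y)}"
  have "finite V"
    by (rule finite_subset[of _ "(\<lambda>(a, y). f a y) ` (A \<times> Y)"]) (use A Y in \<open>auto simp: V_def\<close>)
  define \<delta> where "\<delta> = Min (insert 1 V) / 2"
  have \<delta>: "\<delta> > 0" "\<And>v. v \<in> V \<Longrightarrow> \<delta> < v"
  proof -
    have "Min (insert 1 V) > 0" using \<open>finite V\<close> by (subst Min_gr_iff) (auto simp: V_def)
    moreover have "Min (insert 1 V) \<le> v" if "v \<in> V" for v using \<open>finite V\<close> that by simp
    ultimately show "\<delta> > 0" "\<And>v. v \<in> V \<Longrightarrow> \<delta> < v" unfolding \<delta>_def by fastforce+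
  qed
  have iff: "f a y - \<delta> \<noteq> 0 \<and> (f a y - \<delta> > 0 \<longleftrightarrow> f a y > 0)" if "a \<in> A" "y \<in> Y" for a y
    using \<delta> that by (cases "f a y > 0") (force simp: V_def)+
  show ?thesis
  proof (rule card_sign_patterns_le[where f = "\<lambda>a x. f a x - \<delta>"])
    show "inj_on (\<lambda>y. {a \<in> A. 0 < f a y - \<delta>}) Y"
    proof (rule inj_onI)
      fix y z assume yz: "y \<in> Y" "z \<in> Y" "{a \<in> A. 0 < f a y - \<delta>} = {a \<in> A. 0 < f a z - \<delta>}"
      then have "{a \<in> A. 0 < f a y} = {a \<in> A. 0 < f a z}" using iff by blast
      with inj yz(1,2) show "y = z" by (simp add: inj_on_def)
    qed
  qed (use A Y iff in \<open>auto intro!: polyf_diff polyf.const\<close>)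
qed

subsection \<open>Feasibility of strict linear systems\<close>

text \<open>Scale all row values to at least 1 and minimize the number of nonzero coordinates plus
  the number of rows with value different from 1. A nonzero direction supported on \<open>J\<close>
  and vanishing on the rows \<open>I\<close> would allow a further decrease.\<close>

lemma basic_solution:
  fixes W :: "nat \<Rightarrow> nat \<Rightarrow> real"
  assumes "\<forall>i<m. (\<Sum>j<n. W i j * z j) > 0"
  shows "\<exists>I\<subseteq>{..<m}. \<exists>J\<subseteq>{..<n}. \<exists>z. (\<forall>j. j \<notin> J \<longrightarrow> z j = 0) \<and>
    (\<forall>i<m. (\<Sum>j<n. W i j * z j) > 0) \<and> (\<forall>i\<in>I. (\<Sum>j<n. W i j * z j) = 1) \<and>
    (\<forall>u. (\<forall>j. j \<notin> J \<longrightarrow> u j = 0) \<longrightarrow> (\<forall>i\<in>I. (\<Sum>j<n. W i j * u j) = 0) \<longrightarrow> (\<forall>j. u j = 0))"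
proof -
  define w where "w = (\<lambda>z i. \<Sum>j<n. W i j * z j)"
  have w_line: "w (\<lambda>j. z j + t * u j) i = w z i + t * w u i" for z u t i
    by (simp add: w_def distrib_left sum.distrib sum_distrib_left mult_ac)
  define feas where "feas = (\<lambda>z. (\<forall>j\<ge>n. z j = 0) \<and> (\<forall>i<m. w z i \<ge> 1))"
  define \<mu> where "\<mu> = (\<lambda>z. card {j. j < n \<and> z j \<noteq> 0} + card {i. i < m \<and> w z i \<noteq> 1})"
  have "\<exists>z. feas z"
  proof -
    define c where "c = Min (insert 1 (w z ` {..<m}))"
    have c: "c > 0" "\<And>i. i < m \<Longrightarrow> c \<le> w z i"
      unfolding c_def using assms by (auto simp: w_def)
    let ?z = "\<lambda>j. if j < n then z j / c else 0"
    have "w ?z i = w z i / c" for i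
      unfolding w_def sum_divide_distrib by (rule sum.cong) auto
    then have "feas ?z" using c by (auto simp: feas_def)
    then show ?thesis by blast
  qed
  then obtain z where z: "feas z" "\<And>y. feas y \<Longrightarrow> \<mu> z \<le> \<mu> y"
    using ex_has_least_nat[of feas _ \<mu>] by blast
  define I where "I = {i. i < m \<and> w z i = 1}"
  define J where "J = {j. j < n \<and> z j \<noteq> 0}"
  have "u j0 = 0" if u: "\<forall>j. j \<notin> J \<longrightarrow> u j = 0" "\<forall>i\<in>I. w u i = 0" for u j0
  proof (rule ccontr)
    assume "u j0 \<noteq> 0"
    then have "j0 \<in> J" using u by blast
    \<comment> \<open>The steps along \<open>u\<close> at which a coordinate becomes 0 or a row
      becomes tight. The one of least absolute value keeps every row at least 1.\<close>
    define A where "A = (\<lambda>j. - z j / u j) ` {j. j < n \<and> u j \<noteq> 0} \<union>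
      (\<lambda>i. (1 - w z i) / w u i) ` {i. i < m \<and> w u i \<noteq> 0}"
    have "finite A" "A \<noteq> {}" using \<open>u j0 \<noteq> 0\<close> \<open>j0 \<in> J\<close> by (auto simp: A_def J_def)
    then obtain t where t: "t \<in> A" "\<And>s. s \<in> A \<Longrightarrow> \<bar>t\<bar> \<le> \<bar>s\<bar>"
      using arg_min_if_finite[of A abs] by (metis linorder_not_less)
    define y where "y = (\<lambda>j. z j + t * u j)"
    have wy: "w y i = w z i + t * w u i" for i unfolding y_def by (rule w_line)
    have "w y i \<ge> 1" if "i < m" for i
    proof (cases "w u i = 0")
      case True
      then show ?thesis using z(1) that by (simp add: wy feas_def)
    next
      case False
      then have "\<bar>t\<bar> \<le> \<bar>(1 - w z i) / w u i\<bar>" using that by (intro t(2)) (auto simp: A_def)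
      then have "\<bar>t * w u i\<bar> \<le> \<bar>1 - w z i\<bar>" using False by (simp add: abs_mult field_simps)
      moreover have "w z i \<ge> 1" using z(1) that by (simp add: feas_def)
      ultimately show ?thesis by (simp add: wy)
    qed
    then have "feas y" using z(1) u(1) by (auto simp: feas_def y_def J_def)
    have sub: "{j. j < n \<and> y j \<noteq> 0} \<subseteq> {j. j < n \<and> z j \<noteq> 0}"
      "{i. i < m \<and> w y i \<noteq> 1} \<subseteq> {i. i < m \<and> w z i \<noteq> 1}"
      subgoal using u(1) by (auto simp: y_def J_def)
      subgoal using u(2) by (auto simp: wy I_def)
      done
    from t(1) have "\<mu> y < \<mu> z" unfolding A_def
    proof (elim UnE imageE CollectE conjE)
      fix j assume j: "t = - z j / u j" "j < n" "u j \<noteq> 0"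
      then have "j \<in> J" "y j = 0" using u(1) by (auto simp: y_def)
      then have "{j. j < n \<and> y j \<noteq> 0} \<subset> {j. j < n \<and> z j \<noteq> 0}" using sub(1) by (auto simp: J_def)
      then show ?thesis unfolding \<mu>_def
        using sub(2) by (intro add_less_le_mono psubset_card_mono card_mono) auto
    next
      fix i assume i: "t = (1 - w z i) / w u i" "i < m" "w u i \<noteq> 0"
      then have "w z i \<noteq> 1" "w y i = 1" using u(2) by (auto simp: wy I_def)
      then have "{i. i < m \<and> w y i \<noteq> 1} \<subset> {i. i < m \<and> w z i \<noteq> 1}" using sub(2) i(2) by auto
      then show ?thesis unfolding \<mu>_def
        using sub(1) by (intro add_le_less_mono psubset_card_mono card_mono) auto
    qed
    with z(2)[OF \<open>feas y\<close>] show False by simp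
  qed
  then have "\<forall>u. (\<forall>j. j \<notin> J \<longrightarrow> u j = 0) \<longrightarrow> (\<forall>i\<in>I. w u i = 0) \<longrightarrow> (\<forall>j. u j = 0)" by metis
  moreover have "\<forall>j. j \<notin> J \<longrightarrow> z j = 0" using z(1) by (auto simp: J_def feas_def)
  moreover have "\<forall>i<m. w z i > 0"
    using z(1) by (auto simp: feas_def intro: less_le_trans[of 0 1])
  moreover have "I \<subseteq> {..<m}" "J \<subseteq> {..<n}" "\<forall>i\<in>I. w z i = 1" by (auto simp: I_def J_def)
  ultimately show ?thesis unfolding w_def
    by (intro exI[of _ I] exI[of _ J] exI[of _ z] conjI)
qed

section \<open>Gram matrices and Cramer's rule\<close>

text \<open>The selected rows and columns need not form a square matrix, so the normal equations are
  used. Padding by the identity outside \<open>J\<close> fixes the size at \<open>n\<close> and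
  forces the other coordinates to be 0.\<close>

definition gram :: "nat \<Rightarrow> nat set \<Rightarrow> nat set \<Rightarrow> (nat \<Rightarrow> nat \<Rightarrow> real) \<Rightarrow> real mat" where
  "gram n I J W = mat n n (\<lambda>(p, q).
     if p \<in> J \<and> q \<in> J then \<Sum>i\<in>I. W i p * W i q else if p = q then 1 else 0)"

definition gram_rhs :: "nat \<Rightarrow> nat set \<Rightarrow> nat set \<Rightarrow> (nat \<Rightarrow> nat \<Rightarrow> real) \<Rightarrow> real vec" where
  "gram_rhs n I J W = vec n (\<lambda>p. if p \<in> J then \<Sum>i\<in>I. W i p else 0)"

text \<open>The value of row \<open>i\<close> at the Cramer solution of the normal equations
  \<open>\<Sum>\<^sub>i\<^sub>\<in>\<^sub>I W i p * (W i \<bullet> z - 1) = 0\<close> (\<open>p \<in> J\<close>), scaled by the squared determinant.\<close>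

definition row_test :: "nat \<Rightarrow> nat set \<Rightarrow> nat set \<Rightarrow> nat \<Rightarrow> (nat \<Rightarrow> nat \<Rightarrow> real) \<Rightarrow> real" where
  "row_test n I J i W = (\<Sum>p<n. W i p * det (replace_col (gram n I J W) (gram_rhs n I J W) p))
     * det (gram n I J W)"

lemma gram_carrier [simp]: "gram n I J W \<in> carrier_mat n n"
  by (simp add: gram_def)

lemma gram_mult:
  assumes "J \<subseteq> {..<n}" "\<forall>j. j \<notin> J \<longrightarrow> u j = 0" "p < n"
  shows "(gram n I J W *\<^sub>v vec n u) $ p = (if p \<in> J then \<Sum>i\<in>I. W i p * (\<Sum>q<n. W i q * u q) else u p)"
proof -
  have "(gram n I J W *\<^sub>v vec n u) $ p = (\<Sum>q<n. gram n I J W $$ (p, q) * u q)"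
    using assms(3) by (simp add: gram_def scalar_prod_def lessThan_atLeast0)
  also have "\<dots> = (\<Sum>q<n. if p \<in> J then (\<Sum>i\<in>I. W i p * W i q) * u q else if p = q then u q else 0)"
    using assms by (intro sum.cong) (auto simp: gram_def)
  also have "\<dots> = (if p \<in> J then \<Sum>i\<in>I. W i p * (\<Sum>q<n. W i q * u q) else u p)"
    using assms(3) sum.swap[of "\<lambda>q i. W i p * W i q * u q" I "{..<n}"]
    by (simp add: sum_distrib_right sum_distrib_left mult.assoc)
  finally show ?thesis .
qed

text \<open>A kernel vector vanishes outside \<open>J\<close> because of the padding; pairing it
  with its image gives a sum of squares of the row values over \<open>I\<close>, so these vanish as
  well.\<close>

lemma gram_det_nonzero:
  assumes J: "J \<subseteq> {..<n}" and I: "finite I"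
    and inj: "\<forall>u. (\<forall>j. j \<notin> J \<longrightarrow> u j = 0) \<longrightarrow> (\<forall>i\<in>I. (\<Sum>j<n. W i j * u j) = 0) \<longrightarrow> (\<forall>j. u j = 0)"
  shows "det (gram n I J W) \<noteq> 0"
proof
  assume "det (gram n I J W) = 0"
  then obtain v where v: "v \<in> carrier_vec n" "v \<noteq> 0\<^sub>v n" "gram n I J W *\<^sub>v v = 0\<^sub>v n"
    using det_0_iff_vec_prod_zero[OF gram_carrier] by blast
  have "v $ p = 0" if "p < n" "p \<notin> J" for p
  proof -
    have "0 = (gram n I J W *\<^sub>v v) $ p" using v that by simp
    also have "\<dots> = (\<Sum>q<n. gram n I J W $$ (p, q) * v $ q)"
      using v(1) that by (simp add: gram_def scalar_prod_def lessThan_atLeast0)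
    also have "\<dots> = (\<Sum>q<n. if p = q then v $ q else 0)"
      using that by (intro sum.cong) (auto simp: gram_def)
    finally show ?thesis using that by simp
  qed
  moreover define u where "u = (\<lambda>p. if p < n then v $ p else 0)"
  ultimately have u: "\<forall>j. j \<notin> J \<longrightarrow> u j = 0" by simp
  have vu: "v = vec n u" using v(1) by (auto simp: u_def)
  have "(\<Sum>i\<in>I. W i p * (\<Sum>q<n. W i q * u q)) = 0" if "p \<in> J" for p
    using gram_mult[OF J u, of p I W] v(3) that J vu by (auto simp: subset_iff)
  then have "0 = (\<Sum>p<n. u p * (\<Sum>i\<in>I. W i p * (\<Sum>q<n. W i q * u q)))"
    using u by (intro sum.neutral[symmetric]) auto
  also have "\<dots> = (\<Sum>i\<in>I. (\<Sum>p<n. W i p * u p) * (\<Sum>q<n. W i q * u q))"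
    unfolding sum_distrib_left[of "u _"] sum_distrib_right
    by (subst sum.swap) (simp add: mult_ac)
  finally have "\<forall>i\<in>I. (\<Sum>j<n. W i j * u j) = 0"
    using I by (subst (asm) eq_commute, subst (asm) sum_nonneg_eq_0_iff) auto
  with inj u have "u = (\<lambda>_. 0)" by blast
  with vu v(2) show False by (auto simp: zero_vec_def)
qed

text \<open>Only a basic solution has to be tested: it solves a nonsingular normal system.\<close>

lemma strict_system_feasible_iff:
  "(\<exists>z. \<forall>i<m. (\<Sum>j<n. W i j * z j) > 0) \<longleftrightarrow>
   (\<exists>I\<subseteq>{..<m}. \<exists>J\<subseteq>{..<n}. \<forall>i<m. row_test n I J i W > 0)"
proof
  assume "\<exists>z. \<forall>i<m. (\<Sum>j<n. W i j * z j) > 0"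
  then obtain z0 where "\<forall>i<m. (\<Sum>j<n. W i j * z0 j) > 0" by blast
  from basic_solution[OF this] obtain I J z where IJ: "I \<subseteq> {..<m}" "J \<subseteq> {..<n}"
    and z: "\<forall>j. j \<notin> J \<longrightarrow> z j = 0" "\<forall>i<m. (\<Sum>j<n. W i j * z j) > 0" "\<forall>i\<in>I. (\<Sum>j<n. W i j * z j) = 1"
    and inj: "\<forall>u. (\<forall>j. j \<notin> J \<longrightarrow> u j = 0) \<longrightarrow> (\<forall>i\<in>I. (\<Sum>j<n. W i j * u j) = 0) \<longrightarrow> (\<forall>j. u j = 0)"
    by (elim exE conjE) (rule that)
  have det: "det (gram n I J W) \<noteq> 0"
    using gram_det_nonzero[OF IJ(2) finite_subset[OF IJ(1)] inj] by simp
  have "gram n I J W *\<^sub>v vec n z = gram_rhs n I J W"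
  proof (rule eq_vecI)
    fix p assume "p < dim_vec (gram_rhs n I J W)"
    then show "(gram n I J W *\<^sub>v vec n z) $ p = gram_rhs n I J W $ p"
      using z gram_mult[OF IJ(2) z(1), of p I W] by (simp add: gram_rhs_def)
  qed (simp add: gram_rhs_def gram_def)
  then have cramer: "det (replace_col (gram n I J W) (gram_rhs n I J W) p) = z p * det (gram n I J W)"
    if "p < n" for p
    using cramer_lemma_mat[OF gram_carrier[of n I J W], of "vec n z" p] that by simp
  \<comment> \<open>By Cramer's rule the test is the row value at \<open>z\<close> times a nonzero
    square.\<close>
  have "row_test n I J i W = (\<Sum>j<n. W i j * z j) * (det (gram n I J W))\<^sup>2" for i
    unfolding row_test_def power2_eq_square mult.assoc[symmetric] sum_distrib_right
    by (intro sum.cong) (auto simp: cramer)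
  then show "\<exists>I\<subseteq>{..<m}. \<exists>J\<subseteq>{..<n}. \<forall>i<m. row_test n I J i W > 0"
    using IJ z(2) det by (intro exI[of _ I] exI[of _ J] conjI) auto
next
  assume "\<exists>I\<subseteq>{..<m}. \<exists>J\<subseteq>{..<n}. \<forall>i<m. row_test n I J i W > 0"
  \<comment> \<open>Conversely, the vector of Cramer numerators times the determinant is itself a
    solution: its row values are the row tests.\<close>
  then obtain I J where "\<forall>i<m. row_test n I J i W > 0" by blast
  then show "\<exists>z. \<forall>i<m. (\<Sum>j<n. W i j * z j) > 0"
    by (intro exI[of _ "\<lambda>p. det (replace_col (gram n I J W) (gram_rhs n I J W) p) * det (gram n I J W)"])
      (simp add: row_test_def sum_distrib_right mult.assoc)
qed

lemma polyf_det:
  assumes "\<And>y. M y \<in> carrier_mat n n" "\<And>i j. i < n \<Longrightarrow> j < n \<Longrightarrow> polyf K t (\<lambda>y. M y $$ (i, j))"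
  shows "polyf K (n * t) (\<lambda>y. det (M y))"
proof -
  have "polyf K (card {0..<n} * t) (\<lambda>y. \<Prod>i = 0..<n. M y $$ (i, p i))" if "p permutes {0..<n}" for p
  proof (rule polyf_prod)
    fix i assume i: "i \<in> {0..<n}"
    with that have "p i \<in> {0..<n}" by (simp only: permutes_in_image)
    with i show "polyf K t (\<lambda>y. M y $$ (i, p i))" using assms(2) by simp
  qed
  then show ?thesis
    unfolding det_def'[OF assms(1)] by (intro polyf_sum polyf_cmult) simp
qed

text \<open>Gram entries have degree 2, so each of the two determinants contributes
  \<open>2 * n\<close>; the entry of row \<open>i\<close> contributes the remaining 1.\<close>

lemma polyf_row_test:
  assumes W: "\<And>i p. polyf K 1 (\<lambda>y. W y i p)" and I: "finite I"
  shows "polyf K (4 * n + 1) (\<lambda>y. row_test n I J i (W y))"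
proof -
  have gram: "polyf K 2 (\<lambda>y. gram n I J (W y) $$ (p, q))" if "p < n" "q < n" for p q
  proof -
    have "polyf K 2 (\<lambda>y. W y i p * W y i q)" for i
      using polyf_mult[OF W W] by (simp add: numeral_2_eq_2)
    then have "polyf K 2 (\<lambda>y. \<Sum>i\<in>I. W y i p * W y i q)" by (rule polyf_sum)
    moreover have "(\<lambda>y. gram n I J (W y) $$ (p, q)) = (if p \<in> J \<and> q \<in> J
        then (\<lambda>y. \<Sum>i\<in>I. W y i p * W y i q) else (\<lambda>_. if p = q then 1 else 0))"
      using that by (auto simp: gram_def)
    ultimately show ?thesis by (simp add: polyf.const del: if_split)
  qed
  have rhs: "polyf K 2 (\<lambda>y. gram_rhs n I J (W y) $ p)" if "p < n" for p
    using that by (cases "p \<in> J") (auto simp: gram_rhs_def intro!: polyf_sum polyf.const polyf_mono[OF W])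
  have det: "polyf K (n * 2) (\<lambda>y. det (gram n I J (W y)))"
    by (intro polyf_det gram) auto
  have "polyf K (n * 2) (\<lambda>y. det (replace_col (gram n I J (W y)) (gram_rhs n I J (W y)) p))" for p
  proof (rule polyf_det)
    show "replace_col (gram n I J (W y)) (gram_rhs n I J (W y)) p \<in> carrier_mat n n" for y
      by (simp add: replace_col_def gram_def)
    show "polyf K 2 (\<lambda>y. replace_col (gram n I J (W y)) (gram_rhs n I J (W y)) p $$ (i, j))"
      if "i < n" "j < n" for i j
      using that gram rhs by (cases "j = p")
        (auto simp: replace_col_def gram_def[THEN arg_cong[of _ _ dim_row]]
          gram_def[THEN arg_cong[of _ _ dim_col]])
  qed
  then have "polyf K (1 + n * 2)
      (\<lambda>y. \<Sum>p<n. W y i p * det (replace_col (gram n I J (W y)) (gram_rhs n I J (W y)) p))"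
    by (intro polyf_sum polyf_mult W)
  from polyf_mult[OF this det] show ?thesis
    by (auto simp: row_test_def algebra_simps intro: polyf_mono)
qed

subsection \<open>The upper bound\<close>

definition open_prism :: "nat \<Rightarrow> nat set \<Rightarrow> nat set \<Rightarrow> (nat \<Rightarrow> nat \<Rightarrow> real) \<Rightarrow> (nat \<Rightarrow> real)
    \<Rightarrow> (nat \<Rightarrow> nat \<Rightarrow> real) \<Rightarrow> (nat \<Rightarrow> real) \<Rightarrow> (nat \<Rightarrow> real) set" where
  "open_prism d L U am bm ap bp = {x \<in> Rd d. \<forall>i<d.
      (i \<in> L \<longrightarrow> (\<Sum>j<i. am i j * x j) + bm i < x i) \<and>
      (i \<in> U \<longrightarrow> x i < (\<Sum>j<i. ap i j * x j) + bp i)}"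

lemma finite_common_radius:
  assumes "finite A" "\<And>a. a \<in> A \<Longrightarrow> \<exists>e>0. P a e" "\<And>a e e'. P a e \<Longrightarrow> e' \<le> e \<Longrightarrow> P a e'"
  shows "\<exists>e>0::real. \<forall>a\<in>A. P a e"
  using assms(1,2)
proof (induction A rule: finite_induct)
  case empty
  show ?case by (intro exI[of _ 1]) auto
next
  case (insert a A)
  then obtain e1 e2 where "e1 > 0" "e2 > 0" "P a e1" "\<forall>a\<in>A. P a e2" by (metis insertCI)
  then show ?case using assms(3) by (intro exI[of _ "min e1 e2"]) (auto simp: min_def)
qed

lemma affine_pos_nearby:
  fixes x c :: "nat \<Rightarrow> real"
  assumes "(\<Sum>j<d. c j * x j) + b > 0"
  shows "\<exists>e>0. \<forall>y. (\<forall>j<d. \<bar>y j - x j\<bar> < e) \<longrightarrow> (\<Sum>j<d. c j * y j) + b > 0"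
proof -
  \<comment> \<open>The radius is the value \<open>v\<close> divided by the l1-norm of the
    coefficients, plus 1 to avoid division by 0.\<close>
  define s where "s = (\<Sum>j<d. \<bar>c j\<bar>)"
  define v where "v = (\<Sum>j<d. c j * x j) + b"
  have s: "s \<ge> 0" by (simp add: s_def sum_nonneg)
  have "(\<Sum>j<d. c j * y j) + b > 0" if y: "\<forall>j<d. \<bar>y j - x j\<bar> < v / (s + 1)" for y
  proof -
    have "\<bar>\<Sum>j<d. c j * (y j - x j)\<bar> \<le> (\<Sum>j<d. \<bar>c j\<bar> * (v / (s + 1)))"
      by (rule order_trans[OF sum_abs sum_mono])
        (use y assms s in \<open>simp add: abs_mult less_imp_le mult_left_mono del: times_divide_eq_right\<close>)
    also have "\<dots> = s * (v / (s + 1))" by (simp only: s_def sum_distrib_right)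
    also have "\<dots> < v" using assms[folded v_def] s by (simp add: field_simps)
    finally have "\<bar>(\<Sum>j<d. c j * y j) - (\<Sum>j<d. c j * x j)\<bar> < v"
      by (simp add: right_diff_distrib sum_subtractf)
    then show ?thesis by (simp add: v_def)
  qed
  moreover have "v / (s + 1) > 0" using assms[folded v_def] s by simp
  ultimately show ?thesis by blast
qed

text \<open>The bounds on coordinate \<open>i\<close> involve only earlier coordinates, so moving
  \<open>x i\<close> alone rules out equality. Conversely, finitely many strict affine inequalities
  persist on a common neighbourhood.\<close>

lemma interior_prism: "interior_d d (prism d L U am bm ap bp) = open_prism d L U am bm ap bp"
proof (intro equalityI subsetI)
  fix x assume "x \<in> interior_d d (prism d L U am bm ap bp)"
  then obtain e where x: "x \<in> Rd d" "e > 0"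
    "\<And>y. y \<in> Rd d \<Longrightarrow> (\<forall>i<d. \<bar>y i - x i\<bar> < e) \<Longrightarrow> y \<in> prism d L U am bm ap bp"
    by (auto simp: interior_d_def)
  have perturb: "(i \<in> L \<longrightarrow> (\<Sum>j<i. am i j * x j) + bm i \<le> x i + h) \<and>
      (i \<in> U \<longrightarrow> x i + h \<le> (\<Sum>j<i. ap i j * x j) + bp i)" if "i < d" "\<bar>h\<bar> < e" for i h
  proof -
    have "x(i := x i + h) \<in> prism d L U am bm ap bp"
      using x that by (intro x(3)) (auto simp: Rd_def)
    then show ?thesis using that(1) by (auto simp: prism_def)
  qed
  have "(i \<in> L \<longrightarrow> (\<Sum>j<i. am i j * x j) + bm i < x i) \<and>
      (i \<in> U \<longrightarrow> x i < (\<Sum>j<i. ap i j * x j) + bp i)" if "i < d" for i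
    using perturb[OF that, of "- (e / 2)"] perturb[OF that, of "e / 2"] x(2) by auto
  with x(1) show "x \<in> open_prism d L U am bm ap bp" by (simp add: open_prism_def)
next
  fix x assume x: "x \<in> open_prism d L U am bm ap bp"
  have ext: "(\<Sum>j<d. (if j < i then c j else if j = i then r else 0) * y j) = (\<Sum>j<i. c j * y j) + r * y i"
    if "i < d" for c :: "nat \<Rightarrow> real" and r y i
  proof -
    have "(\<Sum>j<d. (if j < i then c j else if j = i then r else 0) * y j) =
        (\<Sum>j<Suc i. (if j < i then c j else if j = i then r else 0) * y j)"
      using that by (intro sum.mono_neutral_right) auto
    then show ?thesis by simp
  qed
  define P where "P = (\<lambda>i e. \<forall>y. (\<forall>j<d. \<bar>y j - x j\<bar> < e) \<longrightarrow>
      (i \<in> L \<longrightarrow> (\<Sum>j<i. am i j * y j) + bm i < y i) \<and>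
      (i \<in> U \<longrightarrow> y i < (\<Sum>j<i. ap i j * y j) + bp i))"
  have lower: "\<exists>e>0. \<forall>y. (\<forall>j<d. \<bar>y j - x j\<bar> < e) \<longrightarrow> (\<Sum>j<i. am i j * y j) + bm i < y i"
    if "i < d" "i \<in> L" for i
  proof -
    let ?c = "\<lambda>j. if j < i then - am i j else if j = i then 1 else 0"
    have "(\<Sum>j<d. ?c j * y j) + - bm i = y i - ((\<Sum>j<i. am i j * y j) + bm i)" for y
      unfolding ext[OF that(1)] by (simp add: sum_negf)
    from affine_pos_nearby[of ?c x d "- bm i", unfolded this] show ?thesis
      using x that by (simp add: open_prism_def)
  qed
  have upper: "\<exists>e>0. \<forall>y. (\<forall>j<d. \<bar>y j - x j\<bar> < e) \<longrightarrow> y i < (\<Sum>j<i. ap i j * y j) + bp i"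
    if "i < d" "i \<in> U" for i
  proof -
    let ?c = "\<lambda>j. if j < i then ap i j else if j = i then -1 else 0"
    have "(\<Sum>j<d. ?c j * y j) + bp i = (\<Sum>j<i. ap i j * y j) + bp i - y i" for y
      unfolding ext[OF that(1)] by simp
    from affine_pos_nearby[of ?c x d "bp i", unfolded this] show ?thesis
      using x that by (simp add: open_prism_def)
  qed
  have "\<exists>e>0. \<forall>i\<in>{..<d}. P i e"
  proof (rule finite_common_radius)
    fix i assume i: "i \<in> {..<d}"
    have one: "(0::real) < 1" by simp
    obtain e1 where e1: "e1 > 0"
      "\<And>y. i \<in> L \<Longrightarrow> (\<forall>j<d. \<bar>y j - x j\<bar> < e1) \<Longrightarrow> (\<Sum>j<i. am i j * y j) + bm i < y i"
      using lower[of i] i one by (metis lessThan_iff)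
    obtain e2 where e2: "e2 > 0"
      "\<And>y. i \<in> U \<Longrightarrow> (\<forall>j<d. \<bar>y j - x j\<bar> < e2) \<Longrightarrow> y i < (\<Sum>j<i. ap i j * y j) + bp i"
      using upper[of i] i one by (metis lessThan_iff)
    have "P i (min e1 e2)" unfolding P_def using e1(2) e2(2) by simp
    then show "\<exists>e>0. P i e" using e1(1) e2(1) by (metis min_less_iff_conj)
  next
    show "P i e'" if "P i e" "e' \<le> e" for i e e'
      using that unfolding P_def by (meson order_less_le_trans)
  qed auto
  then obtain e where e: "e > 0" "\<And>i. i < d \<Longrightarrow> P i e" by auto
  have "y \<in> prism d L U am bm ap bp" if "y \<in> Rd d" "\<forall>j<d. \<bar>y j - x j\<bar> < e" for y
    using e(2) that by (auto simp: P_def prism_def less_imp_le)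
  with e(1) x show "x \<in> interior_d d (prism d L U am bm ap bp)"
    by (auto simp: interior_d_def open_prism_def)
qed

lemma interior_d_perturb:
  assumes "x \<in> interior_d d P"
  shows "\<exists>e>0. \<forall>y\<in>Rd d. (\<forall>i<d. \<bar>y i - x i\<bar> < e) \<longrightarrow> y \<in> interior_d d P"
proof -
  obtain e where e: "e > 0" "\<And>y. y \<in> Rd d \<Longrightarrow> (\<forall>i<d. \<bar>y i - x i\<bar> < e) \<Longrightarrow> y \<in> P"
    using assms by (auto simp: interior_d_def)
  have "y \<in> interior_d d P" if y: "y \<in> Rd d" "\<forall>i<d. \<bar>y i - x i\<bar> < e / 2" for y
  proof -
    have "z \<in> P" if "z \<in> Rd d" "\<forall>i<d. \<bar>z i - y i\<bar> < e / 2" for z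
      using that y(2) by (intro e(2)) (smt (verit) field_sum_of_halves)+
    with y(1) e(1) show ?thesis by (auto simp: interior_d_def intro!: exI[of _ "e / 2"])
  qed
  with e(1) show ?thesis by (intro exI[of _ "e / 2"]) auto
qed

text \<open>The prism with all \<open>2d\<close> inequalities is coded by a vector \<open>y\<close> of \<open>2d(d+1)\<close> parameters: block
  \<open>i < d\<close> of length \<open>d + 1\<close> holds the \<open>i\<close>-th lower bound, block \<open>d + i\<close> the \<open>i\<close>-th upper bound,
  the constant terms sitting at offset \<open>d\<close>.\<close>

definition coded_prism :: "nat \<Rightarrow> (nat \<Rightarrow> real) \<Rightarrow> (nat \<Rightarrow> real) set" where
  "coded_prism d y = open_prism d {..<d} {..<d}
     (\<lambda>i j. y (i * (d + 1) + j)) (\<lambda>i. y (i * (d + 1) + d))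
     (\<lambda>i j. y ((d + i) * (d + 1) + j)) (\<lambda>i. y ((d + i) * (d + 1) + d))"

lemma param_index_less:
  fixes i j d :: nat
  assumes "i < 2 * d" "j \<le> d"
  shows "i * (d + 1) + j < 2 * d * (d + 1)"
proof -
  have "i * (d + 1) + j < (i + 1) * (d + 1)" using assms by simp
  also have "\<dots> \<le> 2 * d * (d + 1)" using assms by (intro mult_right_mono) auto
  finally show ?thesis .
qed

text \<open>An omitted bound becomes \<open>-B\<close> or \<open>B\<close>, with \<open>B\<close>
  above all coordinates of the points of \<open>X\<close>. The prism may shrink, but it keeps the
  given points.\<close>

lemma ex_coded_prism:
  assumes "finite X" "X \<subseteq> open_prism d L U am bm ap bp"
  shows "\<exists>y. (\<forall>i\<ge>2 * d * (d + 1). y i = 0) \<and> X \<subseteq> coded_prism d y \<and>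
    coded_prism d y \<subseteq> open_prism d L U am bm ap bp"
proof -
  define B where "B = 1 + (\<Sum>x\<in>X. \<Sum>i<d. \<bar>x i\<bar>)"
  have B: "\<bar>x i\<bar> < B" if "x \<in> X" "i < d" for x i
  proof -
    have "\<bar>x i\<bar> \<le> (\<Sum>i<d. \<bar>x i\<bar>)" using that(2) by (intro member_le_sum) auto
    also have "\<dots> \<le> (\<Sum>x\<in>X. \<Sum>i<d. \<bar>x i\<bar>)"
      using that(1) assms(1) by (intro member_le_sum) (auto intro: sum_nonneg)
    finally show ?thesis by (simp add: B_def)
  qed
  define lo where "lo = (\<lambda>i j. if i \<in> L then if j = d then bm i else am i j else if j = d then - B else 0)"
  define up where "up = (\<lambda>i j. if i \<in> U then if j = d then bp i else ap i j else if j = d then B else 0)"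
  define y where "y = (\<lambda>k. if k < 2 * d * (d + 1) then
      let i = k div (d + 1); j = k mod (d + 1) in if i < d then lo i j else up (i - d) j else 0)"
  have dm: "(i * (d + 1) + j) div (d + 1) = i" "(i * (d + 1) + j) mod (d + 1) = j" if "j \<le> d" for i j
    using that by (metis Suc_eq_plus1 add.commute div_mult_self3 div_less le_imp_less_Suc add_0 nat.distinct(1),
      metis Suc_eq_plus1 add.commute mod_mult_self1 mod_less le_imp_less_Suc)
  have y: "y (i * (d + 1) + j) = lo i j" "y ((d + i) * (d + 1) + j) = up i j" if "i < d" "j \<le> d" for i j
    using param_index_less[of i d j] param_index_less[of "d + i" d j]
      dm[OF that(2), of i] dm[OF that(2), of "d + i"] that
    by (simp_all add: y_def Let_def)
  have sums: "(\<Sum>j<i. y (i * (d + 1) + j) * x j) = (\<Sum>j<i. lo i j * x j)"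
    "(\<Sum>j<i. y ((d + i) * (d + 1) + j) * x j) = (\<Sum>j<i. up i j * x j)" if "i < d" for i and x :: "nat \<Rightarrow> real"
    using that y by (auto intro!: sum.cong)
  have cp: "x \<in> coded_prism d y \<longleftrightarrow> x \<in> Rd d \<and> (\<forall>i<d.
      (\<Sum>j<i. lo i j * x j) + lo i d < x i \<and> x i < (\<Sum>j<i. up i j * x j) + up i d)" for x
    unfolding coded_prism_def open_prism_def using sums y by auto
  have lo: "(\<Sum>j<i. lo i j * x j) + lo i d = (if i \<in> L then (\<Sum>j<i. am i j * x j) + bm i else - B)"
    and up: "(\<Sum>j<i. up i j * x j) + up i d = (if i \<in> U then (\<Sum>j<i. ap i j * x j) + bp i else B)"
    if "i < d" for i and x :: "nat \<Rightarrow> real"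
    using that by (auto simp: lo_def up_def intro!: sum.cong sum.neutral)
  have "X \<subseteq> coded_prism d y"
  proof
    fix x assume "x \<in> X"
    then have "x \<in> open_prism d L U am bm ap bp" using assms(2) by blast
    then show "x \<in> coded_prism d y"
      unfolding cp using B[OF \<open>x \<in> X\<close>] by (auto simp: lo up open_prism_def abs_less_iff minus_less_iff)
  qed
  moreover have "coded_prism d y \<subseteq> open_prism d L U am bm ap bp"
  proof
    fix x assume "x \<in> coded_prism d y"
    then show "x \<in> open_prism d L U am bm ap bp"
      unfolding cp open_prism_def by (fastforce simp: lo up)
  qed
  moreover have "\<forall>i\<ge>2 * d * (d + 1). y i = 0" by (simp add: y_def)
  ultimately show ?thesis by blast
qed

text \<open>Coefficients of the homogenized inequality \<open>x\<^sub>i < \<Sum>j<i. v\<^sub>j x\<^sub>j + v\<^sub>d\<close>; the homogenizing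
  variable has index \<open>d\<close>.\<close>

definition aff_row :: "nat \<Rightarrow> nat \<Rightarrow> (nat \<Rightarrow> real) \<Rightarrow> nat \<Rightarrow> real" where
  "aff_row d i v p = (if p < i then v p else if p = i then -1 else if p = d then v d else 0)"

text \<open>Row \<open>2 * d\<close> makes the homogenizing coordinate positive, so that solutions
  can be dehomogenized.\<close>

definition prism_row :: "nat \<Rightarrow> (nat \<Rightarrow> real) \<Rightarrow> nat \<Rightarrow> nat \<Rightarrow> real" where
  "prism_row d y i p =
     (if i < d then - aff_row d i (\<lambda>p. y (i * (d + 1) + p)) p
      else if i < 2 * d then aff_row d (i - d) (\<lambda>p. y (i * (d + 1) + p)) p
      else if p = d then 1 else 0)"

definition hyperplane_row :: "nat \<Rightarrow> (nat \<Rightarrow> real) \<Rightarrow> real \<Rightarrow> nat \<Rightarrow> real" where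
  "hyperplane_row d a b p = (if p < d then a p else - b)"

definition side_system :: "nat \<Rightarrow> (nat \<Rightarrow> real) \<Rightarrow> real \<Rightarrow> real \<Rightarrow> (nat \<Rightarrow> real) \<Rightarrow> nat \<Rightarrow> nat \<Rightarrow> real" where
  "side_system d a b s y i p =
     (if i \<le> 2 * d then prism_row d y i p else s * hyperplane_row d a b p)"

lemma polyf_side_system: "polyf (2 * d * (d + 1)) 1 (\<lambda>y. side_system d a b s y i p)"
proof -
  have "polyf (2 * d * (d + 1)) 1 (\<lambda>y. aff_row d k (\<lambda>p. y (i * (d + 1) + p)) p)"
    if "i < 2 * d" "k < d" for k
  proof -
    have "polyf (2 * d * (d + 1)) 1 (\<lambda>y. y (i * (d + 1) + q))" if "q \<le> d" for q
      using polyf_coord[OF param_index_less[OF \<open>i < 2 * d\<close> that], of 0] by simp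
    moreover have "(\<lambda>y. aff_row d k (\<lambda>p. y (i * (d + 1) + p)) p) =
       (if p < k then (\<lambda>y. y (i * (d + 1) + p)) else if p = k then (\<lambda>_. -1)
        else if p = d then (\<lambda>y. y (i * (d + 1) + d)) else (\<lambda>_. 0))"
      by (auto simp: aff_row_def fun_eq_iff)
    ultimately show ?thesis using that by (auto intro: polyf.const)
  qed
  note aff = this
  consider "i < d" | "d \<le> i" "i < 2 * d" | "i = 2 * d" | "2 * d < i" by linarith
  then show ?thesis
  proof cases
    case 1
    then show ?thesis using polyf_cmult[OF aff[of i], of "-1"]
      by (simp add: side_system_def prism_row_def)
  next
    case 2
    then show ?thesis using aff[of "i - d"] by (simp add: side_system_def prism_row_def)
  qed (auto simp: side_system_def prism_row_def intro!: polyf.const)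
qed

lemma aff_row_sum:
  assumes "i < d"
  shows "(\<Sum>p<d + 1. aff_row d i v p * z p) = (\<Sum>p<i. v p * z p) + v d * z d - z i"
proof -
  have "(\<Sum>p<d. aff_row d i v p * z p) = (\<Sum>p<Suc i. aff_row d i v p * z p)"
    using assms by (intro sum.mono_neutral_right) (auto simp: aff_row_def)
  then show ?thesis using assms by (simp add: aff_row_def)
qed

text \<open>Each row value of a bound is \<open>c\<close> times the slack of that bound at
  \<open>x\<close>, so \<open>c > 0\<close> preserves its sign.\<close>

lemma prism_row_sum_pos_iff:
  assumes c: "c > 0" and x: "x \<in> Rd d" and z: "\<And>p. p < d \<Longrightarrow> z p = c * x p" "z d = c"
  shows "(\<forall>i\<le>2 * d. (\<Sum>p<d + 1. prism_row d y i p * z p) > 0) \<longleftrightarrow> x \<in> coded_prism d y"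
proof -
  have aff: "(\<Sum>p<d + 1. aff_row d i v p * z p) = c * ((\<Sum>p<i. v p * x p) + v d - x i)"
    if "i < d" for i v
  proof -
    have "(\<Sum>p<i. v p * z p) = c * (\<Sum>p<i. v p * x p)"
      unfolding sum_distrib_left using that z by (intro sum.cong) auto
    then show ?thesis unfolding aff_row_sum[OF that] using z that by (simp add: algebra_simps)
  qed
  have "(\<Sum>p<d + 1. prism_row d y i p * z p) > 0 \<longleftrightarrow>
      (\<Sum>j<i. y (i * (d + 1) + j) * x j) + y (i * (d + 1) + d) < x i" if "i < d" for i
    using aff[OF that] c that by (simp add: prism_row_def sum_negf zero_less_mult_iff mult_less_0_iff)
  moreover have "(\<Sum>p<d + 1. prism_row d y (d + i) p * z p) > 0 \<longleftrightarrow>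
      x i < (\<Sum>j<i. y ((d + i) * (d + 1) + j) * x j) + y ((d + i) * (d + 1) + d)" if "i < d" for i
    using aff[OF that, of "\<lambda>p. y ((d + i) * (d + 1) + p)"] c that
    by (simp add: prism_row_def zero_less_mult_iff)
  moreover have "(\<Sum>p<d + 1. prism_row d y (2 * d) p * z p) > 0"
    using c z(2) by (simp add: prism_row_def)
  moreover have "(\<forall>i\<le>2 * d. Q i) \<longleftrightarrow> (\<forall>i<d. Q i) \<and> (\<forall>i<d. Q (d + i)) \<and> Q (2 * d)" for Q :: "nat \<Rightarrow> bool"
  proof (intro iffI allI impI conjI)
    fix i assume Q: "(\<forall>i<d. Q i) \<and> (\<forall>i<d. Q (d + i)) \<and> Q (2 * d)" and "i \<le> 2 * d"
    then consider "i < d" | "i - d < d" "d + (i - d) = i" | "i = 2 * d" by linarith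
    then show "Q i" using Q by cases metis+
  qed auto
  ultimately show ?thesis
    using x by (auto simp: coded_prism_def open_prism_def)
qed

lemma hyperplane_row_sum:
  assumes "\<And>p. p < d \<Longrightarrow> z p = c * x p" "z d = c"
  shows "(\<Sum>p<d + 1. hyperplane_row d a b p * z p) = c * ((\<Sum>p<d. a p * x p) - b)"
proof -
  have "(\<Sum>p<d. hyperplane_row d a b p * z p) = c * (\<Sum>p<d. a p * x p)"
    unfolding sum_distrib_left using assms by (intro sum.cong) (auto simp: hyperplane_row_def)
  then show ?thesis using assms(2) by (simp add: hyperplane_row_def algebra_simps)
qed

text \<open>By convexity and openness, a hyperplane meets an open prism iff the prism has points
  strictly on both sides of it.\<close>

lemma hyperplane_meets_coded_prism_iff:
  assumes "k < d" "a k \<noteq> 0"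
  shows "{x \<in> Rd d. (\<Sum>i<d. a i * x i) = b} \<inter> coded_prism d y \<noteq> {} \<longleftrightarrow>
    (\<forall>s\<in>{1, -1}. \<exists>z. \<forall>i<2 * d + 2. (\<Sum>p<d + 1. side_system d a b s y i p * z p) > 0)"
    (is "?L \<longleftrightarrow> ?R")
proof -
  have split: "(\<forall>i<2 * d + 2. (\<Sum>p<d + 1. side_system d a b s y i p * z p) > 0) \<longleftrightarrow>
    (\<forall>i\<le>2 * d. (\<Sum>p<d + 1. prism_row d y i p * z p) > 0) \<and>
    s * (\<Sum>p<d + 1. hyperplane_row d a b p * z p) > 0" for s z
  proof -
    have "(\<forall>i<2 * d + 2. Q i) \<longleftrightarrow> (\<forall>i\<le>2 * d. Q i) \<and> Q (2 * d + 1)" for Q :: "nat \<Rightarrow> bool"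
      by (metis Suc_eq_plus1 add_2_eq_Suc' less_Suc_eq less_Suc_eq_le)
    moreover have "(\<Sum>p<d + 1. side_system d a b s y (2 * d + 1) p * z p) =
        s * (\<Sum>p<d + 1. hyperplane_row d a b p * z p)"
      unfolding sum_distrib_left by (simp add: side_system_def mult.assoc)
    moreover have "(\<Sum>p<d + 1. side_system d a b s y i p * z p) =
        (\<Sum>p<d + 1. prism_row d y i p * z p)" if "i \<le> 2 * d" for i
      using that by (simp add: side_system_def)
    ultimately show ?thesis by auto
  qed
  show ?thesis
  proof
    assume ?L
    then obtain x where x: "x \<in> Rd d" "(\<Sum>i<d. a i * x i) = b" "x \<in> coded_prism d y" by blast
    obtain e where e: "e > 0"
      "\<And>x'. x' \<in> Rd d \<Longrightarrow> (\<forall>i<d. \<bar>x' i - x i\<bar> < e) \<Longrightarrow> x' \<in> coded_prism d y"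
      using interior_d_perturb[of x d] x(3) unfolding coded_prism_def interior_prism[symmetric] by meson
    show ?R
    proof
      fix s :: real assume "s \<in> {1, -1}"
      then have s: "s * s = 1" by auto
      \<comment> \<open>Moving coordinate \<open>k\<close> by \<open>h\<close> changes the linear
        form by \<open>a k * h\<close>, which has the sign of \<open>s\<close>.\<close>
      define h where "h = s * sgn (a k) * (e / 2)"
      define x' where "x' = x(k := x k + h)"
      have "\<bar>h\<bar> < e" using \<open>s \<in> _\<close> e(1) assms(2) by (auto simp: h_def abs_mult abs_sgn_eq)
      then have "x' \<in> coded_prism d y"
        using x(1) e(1) assms(1) by (intro e(2)) (auto simp: x'_def Rd_def)
      moreover have "x' \<in> Rd d" using x(1) assms(1) by (auto simp: x'_def Rd_def)
      moreover define z where "z = (\<lambda>p. if p = d then 1 else x' p)"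
      ultimately have "\<forall>i\<le>2 * d. (\<Sum>p<d + 1. prism_row d y i p * z p) > 0"
        using prism_row_sum_pos_iff[where c = 1 and x = x' and d = d and z = z and y = y]
        by (simp add: z_def)
      moreover have "(\<Sum>p<d. a p * x' p) - b = a k * h"
        unfolding x(2)[symmetric] using assms(1)
        by (subst (1 2) sum.remove[of _ k]) (auto simp: x'_def algebra_simps intro!: sum.cong)
      then have "s * (\<Sum>p<d + 1. hyperplane_row d a b p * z p) = s * (a k * h)"
        by (subst hyperplane_row_sum[where c = 1 and x = x']) (auto simp: z_def)
      moreover have "s * (a k * h) = (s * s) * \<bar>a k\<bar> * (e / 2)"
        by (simp add: h_def abs_sgn mult_ac)
      moreover have "(s * s) * \<bar>a k\<bar> * (e / 2) > 0" using s assms(2) e(1) by simp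
      ultimately show "\<exists>z. \<forall>i<2 * d + 2. (\<Sum>p<d + 1. side_system d a b s y i p * z p) > 0"
        unfolding split by (intro exI[of _ z]) (simp only:)
    qed
  next
    assume ?R
    then obtain z w where
      z: "\<forall>i\<le>2 * d. (\<Sum>p<d + 1. prism_row d y i p * z p) > 0"
        "(\<Sum>p<d + 1. hyperplane_row d a b p * z p) > 0" and
      w: "\<forall>i\<le>2 * d. (\<Sum>p<d + 1. prism_row d y i p * w p) > 0"
        "- (\<Sum>p<d + 1. hyperplane_row d a b p * w p) > 0"
      unfolding split by (auto simp: sum_negf)
    define \<alpha> where "\<alpha> = (\<Sum>p<d + 1. hyperplane_row d a b p * z p)"
    define \<beta> where "\<beta> = - (\<Sum>p<d + 1. hyperplane_row d a b p * w p)"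
    \<comment> \<open>The weights make the values \<alpha> and \<open>- \<beta>\<close> of the
      hyperplane row cancel, while positivity of the prism rows survives.\<close>
    define u where "u = (\<lambda>p. \<beta> * z p + \<alpha> * w p)"
    have lin: "(\<Sum>p<d + 1. r p * u p) = \<beta> * (\<Sum>p<d + 1. r p * z p) + \<alpha> * (\<Sum>p<d + 1. r p * w p)" for r
      unfolding u_def sum_distrib_left sum.distrib[symmetric] by (intro sum.cong) (auto simp: algebra_simps)
    have pos: "\<alpha> > 0" "\<beta> > 0" using z(2) w(2) by (auto simp: \<alpha>_def \<beta>_def)
    have rows: "(\<Sum>p<d + 1. prism_row d y i p * u p) > 0" if "i \<le> 2 * d" for i
      unfolding lin using z(1) w(1) pos that by (intro add_pos_pos mult_pos_pos) auto
    have "(\<Sum>p<d + 1. hyperplane_row d a b p * u p) = \<beta> * \<alpha> + \<alpha> * - \<beta>"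
      unfolding lin by (simp only: \<alpha>_def \<beta>_def minus_minus)
    then have on: "(\<Sum>p<d + 1. hyperplane_row d a b p * u p) = 0" by simp
    have ud: "u d > 0" using rows[of "2 * d"] by (simp add: prism_row_def)
    define x where "x = (\<lambda>p. if p < d then u p / u d else 0)"
    have x: "x \<in> Rd d" by (simp add: x_def Rd_def)
    have ux: "u p = u d * x p" if "p < d" for p using that ud by (simp add: x_def)
    have "x \<in> coded_prism d y" using prism_row_sum_pos_iff[OF ud x ux refl] rows by blast
    moreover have "(\<Sum>p<d. a p * x p) = b"
      using hyperplane_row_sum[where d = d and z = u and c = "u d" and x = x, OF ux refl, of a b] on ud
      by simp
    ultimately show ?L using x by blast
  qed
qed

section \<open>Counting the ranges on a shattered set\<close>

lemma shattered_subset: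
  assumes "shattered d S" "S' \<subseteq> S" shows "shattered d S'"
  unfolding shattered_def
proof (intro conjI allI impI)
  show "S' \<subseteq> hyperplanes d" using assms by (auto simp: shattered_def)
  fix T assume "T \<subseteq> S'"
  then obtain \<sigma> where "\<sigma> \<in> Sigma_prisms d" "{H \<in> S. H \<inter> interior_d d \<sigma> \<noteq> {}} = T"
    using assms unfolding shattered_def by (meson order_trans)
  then show "\<exists>\<sigma>\<in>Sigma_prisms d. {H \<in> S'. H \<inter> interior_d d \<sigma> \<noteq> {}} = T"
    using assms(2) \<open>T \<subseteq> S'\<close> by (intro bexI[of _ \<sigma>]) auto
qed

text \<open>Each subset of \<open>S\<close> is realized by a parameter vector, and the positivity
  pattern of the row tests at that vector determines the subset. Hence there are at least
  \<open>2 ^ card S\<close> patterns.\<close>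

lemma shattered_growth:
  assumes "finite S" "shattered d S"
  shows "2 ^ card S \<le>
    (2 * (card S * (2 * (2 ^ (2 * d + 2) * (2 ^ (d + 1) * (2 * d + 2))))) * (4 * (d + 1) + 1) + 1)
      ^ (2 * d * (d + 1))"
proof -
  define eqn where "eqn = (\<lambda>H a b k. k < d \<and> a k \<noteq> 0 \<and> {x \<in> Rd d. (\<Sum>i<d. a i * x i) = b} = H)"
  have "\<exists>a b k. eqn H a b k" if "H \<in> S" for H
  proof -
    from that assms(2) have "H \<in> hyperplanes d" by (auto simp: shattered_def)
    then show ?thesis unfolding hyperplanes_def eqn_def by blast
  qed
  then obtain a b k where eqn: "\<And>H. H \<in> S \<Longrightarrow> eqn H (a H) (b H) (k H)" by metis
  have H: "k H < d" "a H (k H) \<noteq> 0" "{x \<in> Rd d. (\<Sum>i<d. a H i * x i) = b H} = H"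
    if "H \<in> S" for H using eqn[OF that] unfolding eqn_def by simp_all
  \<comment> \<open>A test is indexed by the hyperplane, its side, the row and column sets of a
    basic solution, and the row tested.\<close>
  define A where "A = S \<times> {1, -1 :: real} \<times> Pow {..<2 * d + 2} \<times> Pow {..<d + 1} \<times> {..<2 * d + 2}"
  define f where "f = (\<lambda>(H, s, I, J, i) y. row_test (d + 1) I J i (side_system d (a H) (b H) s y))"
  have meets: "H \<inter> coded_prism d y \<noteq> {} \<longleftrightarrow> (\<forall>s\<in>{1, -1}. \<exists>I\<in>Pow {..<2 * d + 2}. \<exists>J\<in>Pow {..<d + 1}.
      \<forall>i\<in>{..<2 * d + 2}. f (H, s, I, J, i) y > 0)" if "H \<in> S" for H y
  proof -
    have "{x \<in> Rd d. (\<Sum>i<d. a H i * x i) = b H} \<inter> coded_prism d y \<noteq> {} \<longleftrightarrow>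
        (\<forall>s\<in>{1, -1}. \<exists>z. \<forall>i<2 * d + 2. (\<Sum>p<d + 1. side_system d (a H) (b H) s y i p * z p) > 0)"
      by (rule hyperplane_meets_coded_prism_iff[where k = "k H" and a = "a H"])
        (use H(1,2)[OF that] in auto)
    also have "\<dots> \<longleftrightarrow> (\<forall>s\<in>{1, -1}. \<exists>I\<subseteq>{..<2 * d + 2}. \<exists>J\<subseteq>{..<d + 1}.
        \<forall>i<2 * d + 2. row_test (d + 1) I J i (side_system d (a H) (b H) s y) > 0)"
      unfolding strict_system_feasible_iff ..
    also have "\<dots> \<longleftrightarrow> (\<forall>s\<in>{1, -1}. \<exists>I\<in>Pow {..<2 * d + 2}. \<exists>J\<in>Pow {..<d + 1}.
      \<forall>i\<in>{..<2 * d + 2}. f (H, s, I, J, i) y > 0)"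
      unfolding f_def prod.case Bex_def Pow_iff Ball_def lessThan_iff ..
    finally show ?thesis unfolding H(3)[OF that] .
  qed
  define realizes where "realizes = (\<lambda>y T.
    (\<forall>i\<ge>2 * d * (d + 1). y i = 0) \<and> {H \<in> S. H \<inter> coded_prism d y \<noteq> {}} = T)"
  have "\<exists>y. realizes y T" if "T \<subseteq> S" for T
  proof -
    have "\<exists>\<sigma>\<in>Sigma_prisms d. {H \<in> S. H \<inter> interior_d d \<sigma> \<noteq> {}} = T"
      using assms(2) that by (simp add: shattered_def)
    then obtain \<sigma> where \<sigma>: "\<sigma> \<in> Sigma_prisms d" "{H \<in> S. H \<inter> interior_d d \<sigma> \<noteq> {}} = T"
      by blast
    then obtain L U am bm ap bp where "\<sigma> = prism d L U am bm ap bp"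
      unfolding Sigma_prisms_def by blast
    with \<sigma>(2) have T: "{H \<in> S. H \<inter> open_prism d L U am bm ap bp \<noteq> {}} = T"
      by (simp add: interior_prism)
    \<comment> \<open>One witness point per hyperplane of \<open>T\<close> is kept in the coded
      prism; its inclusion in the original open prism prevents further hyperplanes from being
      met.\<close>
    then have "\<forall>H\<in>T. \<exists>x. x \<in> H \<inter> open_prism d L U am bm ap bp" by blast
    then obtain x where x: "\<And>H. H \<in> T \<Longrightarrow> x H \<in> H \<inter> open_prism d L U am bm ap bp"
      by metis
    have "finite (x ` T)" using finite_subset[OF that assms(1)] by simp
    moreover have "x ` T \<subseteq> open_prism d L U am bm ap bp" using x by blast
    ultimately obtain y where y: "\<forall>i\<ge>2 * d * (d + 1). y i = 0" "x ` T \<subseteq> coded_prism d y"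
      "coded_prism d y \<subseteq> open_prism d L U am bm ap bp"
      using ex_coded_prism by metis
    have "{H \<in> S. H \<inter> coded_prism d y \<noteq> {}} = T"
    proof (intro equalityI subsetI)
      fix H assume "H \<in> {H \<in> S. H \<inter> coded_prism d y \<noteq> {}}"
      then have "H \<in> {H \<in> S. H \<inter> open_prism d L U am bm ap bp \<noteq> {}}" using y(3) by auto
      then show "H \<in> T" by (simp only: T)
    next
      fix H assume "H \<in> T"
      then have "x H \<in> H \<inter> coded_prism d y" "H \<in> S" using x y(2) that by auto
      then show "H \<in> {H \<in> S. H \<inter> coded_prism d y \<noteq> {}}" by auto
    qed
    with y(1) show ?thesis unfolding realizes_def by blast
  qed
  then obtain y where "\<And>T. T \<subseteq> S \<Longrightarrow> realizes (y T) T" by metis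
  then have y: "\<forall>i\<ge>2 * d * (d + 1). y T i = 0" "{H \<in> S. H \<inter> coded_prism d (y T) \<noteq> {}} = T"
    if "T \<subseteq> S" for T using that by (simp_all add: realizes_def)
  have same: "T = T'" if TT': "T \<subseteq> S" "T' \<subseteq> S"
    and eq: "{a\<in>A. f a (y T) > 0} = {a\<in>A. f a (y T') > 0}" for T T'
  proof -
    have "f (H, s, I, J, i) (y T) > 0 \<longleftrightarrow> f (H, s, I, J, i) (y T') > 0"
      if "H \<in> S" "s \<in> {1, -1}" "I \<in> Pow {..<2 * d + 2}"
        "J \<in> Pow {..<d + 1}" "i \<in> {..<2 * d + 2}" for H s I J i
    proof -
      have "(H, s, I, J, i) \<in> A" using that by (simp add: A_def)
      moreover have "(H, s, I, J, i) \<in> {a\<in>A. f a (y T) > 0} \<longleftrightarrow> (H, s, I, J, i) \<in> {a\<in>A. f a (y T') > 0}"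
        by (simp only: eq)
      ultimately show ?thesis by simp
    qed
    then have "H \<inter> coded_prism d (y T) \<noteq> {} \<longleftrightarrow> H \<inter> coded_prism d (y T') \<noteq> {}" if "H \<in> S" for H
      unfolding meets[OF that] using that by (intro ball_cong bex_cong refl) metis
    then have "{H \<in> S. H \<inter> coded_prism d (y T) \<noteq> {}} = {H \<in> S. H \<inter> coded_prism d (y T') \<noteq> {}}"
      by (intro Collect_cong conj_cong refl)
    then show ?thesis by (simp only: y(2)[OF TT'(1)] y(2)[OF TT'(2)])
  qed
  have "inj_on y (Pow S)"
  proof (rule inj_onI)
    fix T T' assume "T \<in> Pow S" "T' \<in> Pow S" "y T = y T'"
    then show "T = T'" by (intro same) auto
  qed
  then have count: "card (y ` Pow S) = 2 ^ card S"
    using assms(1) by (simp add: card_image card_Pow)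
  have bound: "card (y ` Pow S) \<le> (2 * card A * (4 * (d + 1) + 1) + 1) ^ (2 * d * (d + 1))"
  proof (rule card_positivity_patterns_le)
    show "finite A" using assms(1) by (simp add: A_def)
    show "polyf (2 * d * (d + 1)) (4 * (d + 1) + 1) (f a)" if "a \<in> A" for a
    proof -
      obtain H s I J i where a: "a = (H, s, I, J, i)" by (metis prod_cases5)
      with that have "finite I" by (auto simp: A_def intro: finite_subset)
      from polyf_row_test[OF polyf_side_system this] show ?thesis by (simp only: a f_def prod.case)
    qed
    show "inj_on (\<lambda>y. {a \<in> A. 0 < f a y}) (y ` Pow S)"
    proof (rule inj_onI)
      fix u v assume "u \<in> y ` Pow S" "v \<in> y ` Pow S" and eq: "{a \<in> A. 0 < f a u} = {a \<in> A. 0 < f a v}"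
      then obtain T T' where T: "T \<subseteq> S" "u = y T" "T' \<subseteq> S" "v = y T'" by blast
      have "T = T'" using same[OF T(1,3)] eq unfolding T(2,4) by blast
      then show "u = v" by (simp add: T(2,4))
    qed
    show "finite (y ` Pow S)" using assms(1) by simp
    show "\<forall>i\<ge>2 * d * (d + 1). u i = 0" if "u \<in> y ` Pow S" for u using that y(1) by auto
  qed
  have "card A = card S * (2 * (2 ^ (2 * d + 2) * (2 ^ (d + 1) * (2 * d + 2))))"
    by (simp add: A_def card_cartesian_product card_Pow)
  from bound[unfolded this count] show ?thesis .
qed

text \<open>The growth inequality has the cardinality on both sides. Passing to a subset of size
  \<open>112 * d ^ 3 + 1\<close> bounds the occurrence on the right.\<close>

lemma shattered_card_le:
  assumes "finite S" "shattered d S" "d \<ge> 1"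
  shows "card S \<le> 112 * d ^ 3"
proof (rule ccontr)
  assume "\<not> ?thesis"
  then obtain S' where S': "S' \<subseteq> S" "card S' = 112 * d ^ 3 + 1"
    by (metis Suc_eq_plus1 not_less_eq_eq obtain_subset_with_card_n)
  have d: "d \<le> 2 ^ d" by (simp add: less_imp_le)
  have "d ^ 3 \<ge> 1" using assms(3) by simp
  then have "card S' \<le> 113 * d ^ 3" using S'(2) by simp
  also have "\<dots> \<le> 2 ^ 7 * (2 ^ d) ^ 3" using d by (intro mult_mono power_mono) auto
  finally have m: "card S' \<le> 2 ^ (7 + 3 * d)" by (simp add: power_add power_mult[symmetric] mult.commute)
  have "2 * d + 2 \<le> 4 * d" using assms(3) by simp
  also have "\<dots> \<le> 2 ^ 2 * 2 ^ d" using d by simp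
  finally have f1: "2 * d + 2 \<le> 2 ^ (2 + d)" by (simp add: power_add)
  have "4 * (d + 1) + 1 \<le> 16 * d" using assms(3) by simp
  also have "\<dots> \<le> 2 ^ 4 * 2 ^ d" using d by simp
  finally have f2: "4 * (d + 1) + 1 \<le> 2 ^ (4 + d)" by (simp add: power_add)
  let ?b = "2 * (card S' * (2 * (2 ^ (2 * d + 2) * (2 ^ (d + 1) * (2 * d + 2))))) * (4 * (d + 1) + 1)"
  have "?b \<le> 2 * (2 ^ (7 + 3 * d) * (2 * (2 ^ (2 * d + 2) * (2 ^ (d + 1) * 2 ^ (2 + d))))) * 2 ^ (4 + d)"
    by (intro mult_mono m f1 f2) auto
  also have "\<dots> = 2 ^ (18 + 8 * d)" by (simp add: power_add[symmetric] flip: power_Suc)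
  finally have "?b + 1 \<le> 2 ^ (18 + 8 * d) + 2 ^ (18 + 8 * d)" by (intro add_mono) auto
  \<comment> \<open>For \<open>d \<ge> 1\<close>, \<open>19 + 8 * d \<le> 28 * d\<close>; with the
    exponent bounded by \<open>2 * d * (2 * d)\<close> this gives the constant 112.\<close>
  also have "\<dots> = 2 ^ (19 + 8 * d)" by (simp add: power_add)
  also have "\<dots> \<le> 2 ^ (28 * d)" using assms(3) by (intro power_increasing) auto
  finally have base: "?b + 1 \<le> 2 ^ (28 * d)" .
  have "2 ^ card S' \<le> (?b + 1) ^ (2 * d * (d + 1))"
    using shattered_growth[OF finite_subset[OF S'(1) assms(1)] shattered_subset[OF assms(2) S'(1)]] .
  also have "\<dots> \<le> (2 ^ (28 * d)) ^ (2 * d * (d + 1))" by (rule power_mono[OF base]) simp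
  also have "\<dots> = 2 ^ (28 * d * (2 * d * (d + 1)))" by (simp only: power_mult)
  finally have "card S' \<le> 28 * d * (2 * d * (d + 1))"
    by (simp only: power_increasing_iff one_less_numeral_iff semiring_norm)
  also have "\<dots> \<le> 28 * d * (2 * d * (2 * d))" using assms(3) by (intro mult_left_mono) auto
  also have "\<dots> = 112 * d ^ 3" by (simp add: power3_eq_cube)
  finally show False using S'(2) by simp
qed

subsection \<open>The lower bound\<close>

text \<open>Realizing the singletons already forces injectivity, so the index set counts the
  hyperplanes.\<close>

lemma inj_on_and_shattered_if_realized:
  assumes hyp: "h ` I \<subseteq> hyperplanes d"
    and real: "\<And>T. T \<subseteq> I \<Longrightarrow> \<exists>\<sigma>\<in>Sigma_prisms d. \<forall>i\<in>I. h i \<inter> interior_d d \<sigma> \<noteq> {} \<longleftrightarrow> i \<in> T"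
  shows "inj_on h I \<and> shattered d (h ` I)"
proof
  show "inj_on h I"
  proof (rule inj_onI)
    fix i j assume ij: "i \<in> I" "j \<in> I" "h i = h j"
    obtain \<sigma> where "\<forall>k\<in>I. h k \<inter> interior_d d \<sigma> \<noteq> {} \<longleftrightarrow> k \<in> {i}" using real[of "{i}"] ij(1) by auto
    then have "h i \<inter> interior_d d \<sigma> \<noteq> {}" "h j \<inter> interior_d d \<sigma> \<noteq> {} \<longleftrightarrow> j \<in> {i}"
      using ij(1,2) by simp_all
    then show "i = j" unfolding ij(3) by simp
  qed
  show "shattered d (h ` I)" unfolding shattered_def
  proof (intro conjI allI impI hyp)
    fix T assume T: "T \<subseteq> h ` I"
    obtain \<sigma> where \<sigma>: "\<sigma> \<in> Sigma_prisms d"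
      "\<forall>i\<in>I. h i \<inter> interior_d d \<sigma> \<noteq> {} \<longleftrightarrow> i \<in> {i \<in> I. h i \<in> T}"
      using real[of "{i \<in> I. h i \<in> T}"] by auto
    then have "{H \<in> h ` I. H \<inter> interior_d d \<sigma> \<noteq> {}} = T" using T by auto
    with \<sigma>(1) show "\<exists>\<sigma>\<in>Sigma_prisms d. {H \<in> h ` I. H \<inter> interior_d d \<sigma> \<noteq> {}} = T" by blast
  qed
qed

text \<open>Row \<open>i\<close> of the prism has \<open>i + 1\<close> upper-bound parameters, one for each test plane \<open>(i, k)\<close>,
  \<open>k \<le> i\<close>. The plane \<open>(i, i)\<close> tests the value of the bound at the vertex \<open>0\<close> and \<open>(i, k)\<close> tests it at
  \<open>b\<^sub>k e\<^sub>k\<close>; the slope 12 makes all other points of the prism irrelevant. The additional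
  plane \<open>x\<^sub>d\<^sub>-\<^sub>1 = 0\<close>, with index \<open>(d, d)\<close>, is controlled by the last lower bound.\<close>

definition test_level :: "nat \<Rightarrow> nat \<Rightarrow> real" where
  "test_level i k = (if k = i then 1 else 3)"

definition test_plane :: "nat \<Rightarrow> nat \<times> nat \<Rightarrow> (nat \<Rightarrow> real) set" where
  "test_plane d = (\<lambda>(i, k). if i = d then {x \<in> Rd d. x (d - 1) = 0}
     else {x \<in> Rd d. x i - 12 * (\<Sum>j\<in>{..<i} - {k}. x j) = test_level i k})"

definition test_const :: "(nat \<times> nat) set \<Rightarrow> nat \<Rightarrow> real" where
  "test_const T i = (if (i, i) \<in> T then 2 else 1)"

text \<open>Chosen so that bound \<open>i\<close> at \<open>test_const T k\<close> times the
  \<open>k\<close>-th unit vector is 4 or 3, against test level 3; likewise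
  \<open>test_const\<close> is 2 or 1, against level 1. Since the bounds are strict, equality means
  a miss.\<close>

definition test_coeff :: "(nat \<times> nat) set \<Rightarrow> nat \<Rightarrow> nat \<Rightarrow> real" where
  "test_coeff T i k = ((if (i, k) \<in> T then 4 else 3) - test_const T i) / test_const T k"

definition test_prism :: "nat \<Rightarrow> (nat \<times> nat) set \<Rightarrow> (nat \<Rightarrow> real) set" where
  "test_prism d T = {x \<in> Rd d. \<forall>i<d.
     (if i = d - 1 \<and> (d, d) \<in> T then -1 else 0) < x i \<and>
     x i < (\<Sum>j<i. test_coeff T i j * x j) + test_const T i}"

lemma test_prism_interior: "\<exists>\<sigma>\<in>Sigma_prisms d. interior_d d \<sigma> = test_prism d T"
proof
  let ?P = "prism d UNIV UNIV (\<lambda>_ _. 0) (\<lambda>i. if i = d - 1 \<and> (d, d) \<in> T then -1 else 0)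
    (test_coeff T) (test_const T)"
  show "?P \<in> Sigma_prisms d" unfolding Sigma_prisms_def by blast
  show "interior_d d ?P = test_prism d T"
    unfolding interior_prism by (simp add: open_prism_def test_prism_def)
qed

lemma test_const_bounds: "1 \<le> test_const T i" "test_const T i \<le> 2"
  by (simp_all add: test_const_def)

lemma test_coeff_bounds: "0 \<le> test_coeff T i k" "test_coeff T i k \<le> 3"
  by (simp_all add: test_coeff_def test_const_def)

lemma test_coeff_const:
  "test_coeff T i k * test_const T k = (if (i, k) \<in> T then 4 else 3) - test_const T i"
  using test_const_bounds(1)[of T k] by (simp add: test_coeff_def)

lemma test_plane_hyperplane:
  assumes "(i, k) \<in> insert (d, d) (SIGMA i:{..<d}. {..i})" "d \<ge> 1"
  shows "test_plane d (i, k) \<in> hyperplanes d"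
proof (cases "i = d")
  case True
  let ?a = "\<lambda>j. if j = d - 1 then 1 else 0 :: real"
  have "(\<Sum>j<d. ?a j * x j) = x (d - 1)" for x :: "nat \<Rightarrow> real"
    using assms(2) by (subst sum.remove[of _ "d - 1"]) (auto intro!: sum.neutral)
  then show ?thesis using True assms(2)
    by (auto simp: test_plane_def hyperplanes_def intro!: exI[of _ ?a] exI[of _ "d - 1"])
next
  case False
  then have i: "i < d" using assms(1) by auto
  let ?a = "\<lambda>j. if j = i then 1 else if j < i \<and> j \<noteq> k then -12 else 0 :: real"
  have "(\<Sum>j<d. ?a j * x j) = x i - 12 * (\<Sum>j\<in>{..<i} - {k}. x j)" for x :: "nat \<Rightarrow> real"
  proof -
    have "(\<Sum>j<d. ?a j * x j) = x i + (\<Sum>j\<in>{..<d} - {i}. ?a j * x j)"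
      using i by (subst sum.remove[of _ i]) auto
    also have "(\<Sum>j\<in>{..<d} - {i}. ?a j * x j) = (\<Sum>j\<in>{..<i} - {k}. - 12 * x j)"
      using i by (intro sum.mono_neutral_cong_right) auto
    finally show ?thesis by (simp add: sum_distrib_left sum_negf)
  qed
  then show ?thesis using False i
    by (auto simp: test_plane_def hyperplanes_def intro!: exI[of _ ?a] exI[of _ i])
qed

text \<open>On the prism, \<open>x i\<close> stays strictly below the height of the plane over the
  earlier coordinates.\<close>

lemma test_plane_missed:
  assumes i: "i < d" "k \<le> i" "(i, k) \<notin> T" and x: "x \<in> test_prism d T"
  shows "x \<notin> test_plane d (i, k)"
proof -
  \<comment> \<open>Only the lower bound with index \<open>d - 1\<close> can be negative, and
    \<open>j < i\<close> excludes that index.\<close>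
  have pos: "x j > 0" if "j < i" for j
    using x i that by (auto simp: test_prism_def dest!: spec[of _ j] split: if_splits)
  have upper: "x j < (\<Sum>l<j. test_coeff T j l * x l) + test_const T j" if "j \<le> i" for j
    using x i that by (auto simp: test_prism_def)
  have "x i < test_level i k + 12 * (\<Sum>j\<in>{..<i} - {k}. x j)"
  proof (cases "k = i")
    case True
    have "(\<Sum>l<i. test_coeff T i l * x l) \<le> (\<Sum>l<i. 12 * x l)"
      using pos by (intro sum_mono mult_right_mono order_trans[OF test_coeff_bounds(2)])
        (auto intro: less_imp_le)
    then show ?thesis using upper[of i] True i(3)
      by (simp add: test_level_def test_const_def sum_distrib_left)
  next
    case False
    then have k: "k < i" using i by simp
    have "(\<Sum>l<k. test_coeff T k l * x l) \<le> (\<Sum>l<k. 3 * x l)"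
      using pos k test_coeff_bounds(2)[of T k] by (intro sum_mono mult_right_mono) (auto intro: less_imp_le)
    also have "\<dots> \<le> (\<Sum>l\<in>{..<i} - {k}. 3 * x l)"
      using pos k by (intro sum_mono2) (auto intro: less_imp_le)
    also have "\<dots> = 3 * (\<Sum>l\<in>{..<i} - {k}. x l)" by (simp add: sum_distrib_left)
    finally have "x k \<le> 3 * (\<Sum>l\<in>{..<i} - {k}. x l) + test_const T k"
      using upper[of k] k by simp
    \<comment> \<open>The excess of \<open>x k\<close> over \<open>test_const T k\<close> is at most
      3 times the sum of the other coordinates. A coefficient of at most 3 turns this into 9, and
      the direct contribution of the others adds 3: hence the slope 12.\<close>
    then have "test_coeff T i k * x k \<le> test_coeff T i k * (3 * (\<Sum>l\<in>{..<i} - {k}. x l) + test_const T k)"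
      using test_coeff_bounds(1) by (rule mult_left_mono)
    also have "\<dots> = test_coeff T i k * (3 * (\<Sum>l\<in>{..<i} - {k}. x l)) + (3 - test_const T i)"
      using test_coeff_const[of T i k] i(3) by (simp add: distrib_left)
    also have "test_coeff T i k * (3 * (\<Sum>l\<in>{..<i} - {k}. x l)) \<le> 3 * (3 * (\<Sum>l\<in>{..<i} - {k}. x l))"
      using pos by (intro mult_right_mono test_coeff_bounds(2) mult_nonneg_nonneg sum_nonneg)
        (auto intro: less_imp_le)
    finally have a: "test_coeff T i k * x k \<le> 9 * (\<Sum>l\<in>{..<i} - {k}. x l) + 3 - test_const T i" by simp
    have "(\<Sum>l\<in>{..<i} - {k}. test_coeff T i l * x l) \<le> (\<Sum>l\<in>{..<i} - {k}. 3 * x l)"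
      using pos test_coeff_bounds(2)[of T i] by (intro sum_mono mult_right_mono) (auto intro: less_imp_le)
    then have b: "(\<Sum>l\<in>{..<i} - {k}. test_coeff T i l * x l) \<le> 3 * (\<Sum>l\<in>{..<i} - {k}. x l)"
      by (simp add: sum_distrib_left)
    have "(\<Sum>l<i. test_coeff T i l * x l) = test_coeff T i k * x k + (\<Sum>l\<in>{..<i} - {k}. test_coeff T i l * x l)"
      using k by (subst sum.remove[of _ k]) auto
    then show ?thesis using upper[of i] a b False by (simp add: test_level_def)
  qed
  then show ?thesis using i(1) by (simp add: test_plane_def)
qed

lemma test_plane_met:
  assumes i: "i < d" "k \<le> i" "(i, k) \<in> T"
  shows "test_plane d (i, k) \<inter> test_prism d T \<noteq> {}"
proof -
  \<comment> \<open>This choice gives \<open>12 * (n * \<delta>) \<le> 1 - 12 * \<delta>\<close>,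
    which fits into the gap of 1 between bound and level despite a loss of at most
    \<open>3 * \<delta>\<close>.\<close>
  define \<delta> :: real where "\<delta> = 1 / (12 * real d + 12)"
  have "12 * real d + 12 > 0" by (simp add: add_nonneg_pos)
  then have "\<delta> > 0" "(12 * real d + 12) * \<delta> = 1" by (simp_all add: \<delta>_def)
  then have \<delta>: "\<delta> > 0" "12 * (real d * \<delta>) + 12 * \<delta> = 1" by (simp_all add: distrib_right)
  have \<delta>1: "\<delta> < 1" "12 * \<delta> \<le> 1" using \<delta> mult_nonneg_nonneg[of "real d" \<delta>] by linarith+
  define n where "n = real (card ({..<i} - {k}))"
  have n: "0 \<le> n" "n \<le> real d - (if k = i then 0 else 1)"
  proof -
    show "0 \<le> n" by (simp add: n_def)
    have "card ({..<i} - {k}) \<le> d - (if k = i then 0 else 1)"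
      using i by (auto simp: card_Diff_singleton)
    then show "n \<le> real d - (if k = i then 0 else 1)" using i unfolding n_def
      by (auto simp: of_nat_diff)
  qed
  have "n * \<delta> \<le> real d * \<delta>" using n(2) \<delta>(1) by (intro mult_right_mono) (auto split: if_splits)
  then have n\<delta>: "12 * (n * \<delta>) + 12 * \<delta> \<le> 1" "0 \<le> n * \<delta>" using \<delta> n(1) by (linarith, simp)
  \<comment> \<open>The vertex being tested, pushed by \<delta> into the open prism;
    \<open>x i\<close> is then determined by the plane.\<close>
  define x where "x = (\<lambda>j. if j \<ge> d then 0
     else if j = i then test_level i k + 12 * (n * \<delta>) else if j = k then test_const T k - \<delta> else \<delta>)"
  have xi: "x i = test_level i k + 12 * (n * \<delta>)" using i by (simp add: x_def)
  have pos: "x j > 0" if "j < d" for j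
    using that n\<delta>(2) \<delta>(1) \<delta>1 test_const_bounds(1)[of T k] by (auto simp: x_def test_level_def)
  have nonneg: "(\<Sum>l\<in>A. test_coeff T j l * x l) \<ge> 0" if "A \<subseteq> {..<d}" for A j
    using that pos test_coeff_bounds(1) by (intro sum_nonneg mult_nonneg_nonneg) (auto intro: less_imp_le)
  have "x j < (\<Sum>l<j. test_coeff T j l * x l) + test_const T j" if j: "j < d" for j
  proof -
    consider "j \<noteq> i" | "j = i" "k = i" | "j = i" "k < i" using i by fastforce
    then show ?thesis
    proof cases
      case 1
      then have "x j < test_const T j"
        using j \<delta>(1) \<delta>1 test_const_bounds(1)[of T j] by (auto simp: x_def)
      then show ?thesis using nonneg[of "{..<j}" j] j by (simp add: subset_iff)
    next
      case 2
      then show ?thesis using n\<delta> \<delta>(1) nonneg[of "{..<j}" j] j i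
        by (simp add: x_def test_level_def test_const_def subset_iff)
    next
      case 3
      have "(\<Sum>l<i. test_coeff T i l * x l) =
          test_coeff T i k * x k + (\<Sum>l\<in>{..<i} - {k}. test_coeff T i l * x l)"
        using 3 by (subst sum.remove[of _ k]) auto
      moreover have "(\<Sum>l\<in>{..<i} - {k}. test_coeff T i l * x l) \<ge> 0"
        using i by (intro nonneg) auto
      moreover have "test_coeff T i k * x k = 4 - test_const T i - test_coeff T i k * \<delta>"
        using test_coeff_const[of T i k] i 3 by (simp add: x_def right_diff_distrib)
      moreover have "test_coeff T i k * \<delta> \<le> 3 * \<delta>"
        using \<delta>(1) by (intro mult_right_mono test_coeff_bounds(2)) auto
      moreover have "x i = 3 + 12 * (n * \<delta>)" using 3 i by (simp add: x_def test_level_def)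
      ultimately show ?thesis using n\<delta> \<delta>(1) unfolding \<open>j = i\<close> by linarith
    qed
  qed
  moreover have "(if j = d - 1 \<and> (d, d) \<in> T then -1 else 0) < x j" if "j < d" for j
    using pos[OF that] by auto
  moreover have Rd: "x \<in> Rd d" by (simp add: Rd_def x_def)
  ultimately have "x \<in> test_prism d T" by (simp add: test_prism_def)
  moreover have "(\<Sum>j\<in>{..<i} - {k}. x j) = n * \<delta>"
  proof -
    have "(\<Sum>j\<in>{..<i} - {k}. x j) = (\<Sum>j\<in>{..<i} - {k}. \<delta>)"
      using i by (intro sum.cong) (auto simp: x_def)
    then show ?thesis by (simp add: n_def)
  qed
  then have "x \<in> test_plane d (i, k)"
    using i Rd xi by (simp add: test_plane_def)
  ultimately show ?thesis by blast
qed

lemma last_plane_met_iff: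
  assumes "d \<ge> 1"
  shows "test_plane d (d, d) \<inter> test_prism d T \<noteq> {} \<longleftrightarrow> (d, d) \<in> T"
proof
  assume "test_plane d (d, d) \<inter> test_prism d T \<noteq> {}"
  then obtain x where x: "x (d - 1) = 0" "x \<in> test_prism d T" by (auto simp: test_plane_def)
  show "(d, d) \<in> T"
  proof (rule ccontr)
    assume "(d, d) \<notin> T"
    then have "x (d - 1) > 0" using x(2) assms by (auto simp: test_prism_def)
    with x(1) show False by simp
  qed
next
  assume T: "(d, d) \<in> T"
  \<comment> \<open>The value \<open>1 / 2\<close> lies above the lower bound 0 and below every
    upper bound, which is at least 1; the last coordinate is 0, above its lower bound -1.\<close>
  define x :: "nat \<Rightarrow> real" where "x = (\<lambda>j. if j < d - 1 then 1 / 2 else 0)"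
  have "x i < (\<Sum>j<i. test_coeff T i j * x j) + test_const T i" for i
  proof -
    have "(\<Sum>j<i. test_coeff T i j * x j) \<ge> 0"
      using test_coeff_bounds(1) by (intro sum_nonneg mult_nonneg_nonneg) (auto simp: x_def)
    moreover have "x i \<le> 1 / 2" by (simp add: x_def)
    ultimately show ?thesis using test_const_bounds(1)[of T i] by linarith
  qed
  moreover have "(if i = d - 1 \<and> (d, d) \<in> T then -1 else 0) < x i" if "i < d" for i
    using that T by (auto simp: x_def)
  ultimately have "x \<in> test_plane d (d, d) \<inter> test_prism d T"
    by (auto simp: test_plane_def test_prism_def Rd_def x_def)
  then show "test_plane d (d, d) \<inter> test_prism d T \<noteq> {}" by blast
qed

lemma ex_shattered:
  assumes "d \<ge> 1"
  shows "\<exists>S. finite S \<and> shattered d S \<and> card S = 1 + d * (d + 1) div 2"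
proof -
  define I where "I = insert (d, d) (SIGMA i:{..<d}. {..i})"
  have sum: "(\<Sum>i<d. Suc i) = d * (d + 1) div 2" by (induction d) auto
  have "finite (SIGMA i:{..<d}. {..i})" by simp
  moreover have "(d, d) \<notin> (SIGMA i:{..<d}. {..i})" by simp
  ultimately have I: "finite I" "card I = 1 + d * (d + 1) div 2"
    unfolding I_def by (auto simp: sum simp del: mult_Suc_right)
  have "inj_on (test_plane d) I \<and> shattered d (test_plane d ` I)"
  proof (rule inj_on_and_shattered_if_realized)
    show "test_plane d ` I \<subseteq> hyperplanes d"
      using test_plane_hyperplane[OF _ assms] by (auto simp: I_def)
    fix T assume "T \<subseteq> I"
    obtain \<sigma> where \<sigma>: "\<sigma> \<in> Sigma_prisms d" "interior_d d \<sigma> = test_prism d T"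
      using test_prism_interior by blast
    have met: "test_plane d p \<inter> test_prism d T \<noteq> {} \<longleftrightarrow> p \<in> T" if "p \<in> I" for p
    proof (cases "p = (d, d)")
      case True
      then show ?thesis using last_plane_met_iff[OF assms] by simp
    next
      case False
      obtain i k where p: "p = (i, k)" by fastforce
      moreover have "i < d" "k \<le> i" using that False unfolding p I_def by auto
      ultimately show ?thesis using test_plane_missed[of i d k T] test_plane_met[of i d k T] by blast
    qed
    show "\<exists>\<sigma>\<in>Sigma_prisms d. \<forall>p\<in>I. test_plane d p \<inter> interior_d d \<sigma> \<noteq> {} \<longleftrightarrow> p \<in> T"
      by (intro bexI[OF _ \<sigma>(1)] ballI) (simp only: \<sigma>(2) met)
  qed
  then show ?thesis using I by (intro exI[of _ "test_plane d ` I"]) (auto simp: card_image)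
qed

subsection \<open>The VC-dimension\<close>

theorem theoremv:
  shows "\<exists>C::nat. \<forall>d\<ge>1.
           enat (1 + d * (d + 1) div 2) \<le> vc_dim d \<and> vc_dim d \<le> enat (C * d ^ 3)"
proof (intro exI[of _ 112] allI impI conjI)
  fix d :: nat assume d: "d \<ge> 1"
  obtain S where "finite S" "shattered d S" "card S = 1 + d * (d + 1) div 2"
    using ex_shattered[OF d] by blast
  then show "enat (1 + d * (d + 1) div 2) \<le> vc_dim d"
    unfolding vc_dim_def by (intro Sup_upper) (auto intro!: exI[of _ S])
  show "vc_dim d \<le> enat (112 * d ^ 3)"
    unfolding vc_dim_def
  proof (rule Sup_least)
    fix n assume "n \<in> {enat (card S) |S. finite S \<and> shattered d S}"
    then show "n \<le> enat (112 * d ^ 3)" using shattered_card_le[OF _ _ d] by auto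
  qed
qed

end
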